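(* There exists a constant $C>0$ (that depends neither on $\Omega$ nor on $R$) such that for every admissible module-sequence $\Omega=((\Psi_n,M_n,P_n))_{n\in\mathbb{N}}$ on $L^2(\mathbb{R}^d)$, every $R>0$, every $f\in L^2_R(\mathbb{R}^d)$, every $\omega\in C(\mathbb{R}^d,\mathbb{R})$, and every $\tau\in C^1(\mathbb{R}^d,\mathbb{R}^d)$ with $\|D\tau\|_\infty\le\frac{1}{2d}$, the feature extractor $\Phi_\Omega$ satisfies $$|||\Phi_\Omega(F_{\tau,\omega}f)-\Phi_\Omega(f)|||\le C\big(R\|\tau\|_\infty+\|\omega\|_\infty\big)\|f\|_2,$$ where $(F_{\tau,\omega}f)(x):=e^{2\pi i\omega(x)}f(x-\tau(x))$.
   Context: Notation: $\mathbb{N}=\{1,2,\dots\}$; $L^2(\mathbb{R}^d)$ consists of complex-valued functions. $(T_tf)(x):=f(x-t)$; $(If)(x):=\overline{f(-x)}$; $\widehat f(\omega):=\int_{\mathbb{R}^d}f(x)e^{-2\pi i\langle x,\omega\rangle}dx$ for $f\in L^1(\mathbb{R}^d)$, extended as usual to $L^2(\mathbb{R}^d)$; $(f\ast g)(y):=\int_{\mathbb{R}^d}f(x)g(y-x)dx$. For $R>0$, $L^2_R(\mathbb{R}^d):=\{f\in L^2(\mathbb{R}^d)\mid \operatorname{supp}(\widehat f)\subseteq B_R(0)\}$ with $B_R(0)$ the open ball of radius $R$ centered at $0$. For $\tau:\mathbb{R}^d\to\mathbb{R}^d$ with Jacobian matrix $D\tau$: $\|\tau\|_\infty:=\sup_{x}|\tau(x)|$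 (Euclidean norm), $\|D\tau\|_\infty:=\sup_x\max_{i,j}|(D\tau)(x)_{i,j}|$; $\|\omega\|_\infty:=\sup_x|\omega(x)|$. The quantities $\|\tau\|_\infty$ and $\|\omega\|_\infty$ may be infinite, in which case the bound is trivial. Semi-discrete frame: for a countable index set $\Lambda$ and atoms $\{g_\lambda\}_{\lambda\in\Lambda}\subseteq L^1(\mathbb{R}^d)\cap L^2(\mathbb{R}^d)$, the collection $\{T_bIg_\lambda\}_{(\lambda,b)\in\Lambda\times\mathbb{R}^d}$ is a semi-discrete frame for $L^2(\mathbb{R}^d)$ with frame bounds $A,B>0$ if $A\|f\|_2^2\le\sum_{\lambda\in\Lambda}\int_{\mathbb{R}^d}|\langle f,T_bIg_\lambda\rangle|^2db=\sum_{\lambda\in\Lambda}\|f\ast g_\lambda\|_2^2\le B\|f\|_2^2$ for all $f\in L^2(\mathbb{R}^d)$. Module-sequence: $\Omega=((\Psi_n,M_n,P_n))_{n\in\mathbb{N}}$ where, for each $n$, $\Psi_n=\{T_bIg_{\lambda_n}\}_{b\in\mathbb{R}^d,\,\lambda_n\in\widetilde\Lambda_n}$ is a semi-discrete frame for $L^2(\mathbb{R}^d)$ with countable index set $\widetilde\Lambda_n$ and upper frame bound $B_n>0$, and $M_n,P_n:L^2(\mathbb{R}^d)\to L^2(\mathbb{R}^d)$ are (possibly non-linear) Lipschitz-continuous operators with Lipschitz constants $L_n>0$ and $R_n>0$ respectively (i.e., $\|M_nf-M_nh\|_2\le L_n\|f-h\|_2$ and $\|P_nf-P_nh\|_2\le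 R_n\|f-h\|_2$ for all $f,h$) and with $M_n0=0$, $P_n0=0$. To each layer $n\in\mathbb{N}$ is associated a pooling factor $S_n\ge1$. In each frame $\Psi_n$ one atom, with index $\lambda_n^\ast\in\widetilde\Lambda_n$, is designated as output-generating atom of layer $n-1$: $\chi_{n-1}:=g_{\lambda_n^\ast}$, $n\in\mathbb{N}$. Set $\Lambda_n:=\widetilde\Lambda_n\setminus\{\lambda_n^\ast\}$. $\Omega$ is called admissible if $\max\{B_n,B_nL_n^2R_n^2\}\le1$ for all $n\in\mathbb{N}$. Network: for $\lambda_n\in\Lambda_n$ and $f\in L^2(\mathbb{R}^d)$, $U_n[\lambda_n]f:=S_n^{d/2}\,P_n\big(M_n(f\ast g_{\lambda_n})\big)(S_n\,\cdot)$. Paths: $\Lambda_1^n:=\Lambda_1\times\cdots\times\Lambda_n$ for $n\in\mathbb{N}$, $\Lambda_1^0:=\{e\}$ with $e$ the empty path. For $q=(\lambda_1,\dots,\lambda_n)\in\Lambda_1^n$, $U[q]f:=U_n[\lambda_n]\cdots U_2[\lambda_2]U_1[\lambda_1]f$, and $U[e]f:=f$. Feature extractor: $\Phi_\Omega(f):=\bigcup_{n=0}^\infty\Phi_\Omega^n(f)$ with $\Phi_\Omega^n(f):=\{(U[q]f)\ast\chi_n\}_{q\in\Lambda_1^n}$, regarded as a family indexed by $\mathcal{Q}:=\bigcup_{n=0}^\infty\Lambda_1^n$. For a family $s=\{s_q\}_{q\in\mathcal{Q}}$ in $L^2(\mathbb{R}^d)$, $|||s|||:=(\sum_{q\in\mathcal{Q}}\|s_q\|_2^2)^{1/2}$;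 differences of families are taken index-wise. *)

theory Defs
  imports "HOL-Analysis.Analysis"
begin

section \<open>Signals on \<open>\<real>\<^sup>d\<close>\<close>

text \<open>
  The dimension is \<open>d = CARD('d)\<close>. An element of \<open>L\<^sup>2(\<real>\<^sup>d)\<close> is represented by a Borel
  function; every class has such a representative. Nothing below distinguishes functions that agree
  almost everywhere: in particular, an operator that is Lipschitz for the seminorm \<open>L2_norm\<close> on the
  representatives maps a.e. equal functions to a.e. equal functions, so such operators are
  precisely the (lifted) Lipschitz operators on \<open>L\<^sup>2(\<real>\<^sup>d)\<close>.
\<close>

type_synonym 'd signal = "real ^ 'd \<Rightarrow> complex"

definition L1 :: "'d::finite signal set" where
  "L1 = {f. integrable lborel f}"

definition L2 :: "'d::finite signal set" where
  "L2 = {f. f \<in> borel_measurable lborel \<and> integrable lborel (\<lambda>x. (cmod (f x))\<^sup>2)}"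

definition ennreal_sqrt :: "ennreal \<Rightarrow> ennreal" where
  "ennreal_sqrt x = (if x = \<infinity> then \<infinity> else ennreal (sqrt (enn2real x)))"

lemma ennreal_sqrt_power2 [simp]: "(ennreal_sqrt x)\<^sup>2 = x"
  by (cases x) (auto simp: ennreal_sqrt_def ennreal_power top_power_ennreal)

text \<open>Norms are extended-valued, so that a norm of an object not known to be square-integrable
  (or square-summable) is not silently finite.\<close>

definition L2_norm :: "'d::finite signal \<Rightarrow> ennreal" where
  "L2_norm f = ennreal_sqrt (\<integral>\<^sup>+ x. ennreal ((cmod (f x))\<^sup>2) \<partial>lborel)"

definition L2_inner :: "'d::finite signal \<Rightarrow> 'd signal \<Rightarrow> complex" where
  "L2_inner f g = (\<integral>x. f x * cnj (g x) \<partial>lborel)"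

definition translation :: "real ^ 'd::finite \<Rightarrow> 'd signal \<Rightarrow> 'd signal" where
  "translation t f = (\<lambda>x. f (x - t))"

definition involution :: "'d::finite signal \<Rightarrow> 'd signal" where
  "involution f = (\<lambda>x. cnj (f (- x)))"

definition convolution :: "'d::finite signal \<Rightarrow> 'd signal \<Rightarrow> 'd signal" where
  "convolution f g = (\<lambda>y. \<integral>x. f x * g (y - x) \<partial>lborel)"


section \<open>Band-limited functions\<close>

definition fourier_L1 :: "'d::finite signal \<Rightarrow> 'd signal" where
  "fourier_L1 f = (\<lambda>\<omega>. \<integral>x. f x * exp (- (2 * complex_of_real pi * \<i> * complex_of_real (x \<bullet> \<omega>))) \<partial>lborel)"

text \<open>
  The extension of the Fourier transform from \<open>L\<^sup>1 \<inter> L\<^sup>2\<close> to \<open>L\<^sup>2\<close> by continuity: \<open>F\<close> represents the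
  transform of \<open>f\<close> iff \<open>F\<close> is the \<open>L\<^sup>2\<close>-limit of the transforms of some sequence in \<open>L\<^sup>1 \<inter> L\<^sup>2\<close>
  converging to \<open>f\<close> in \<open>L\<^sup>2\<close>. By Plancherel's theorem such an \<open>F\<close> exists for every \<open>f\<close> in \<open>L\<^sup>2\<close>, is
  unique up to null sets, and does not depend on the sequence.
\<close>

definition has_fourier_L2 :: "'d::finite signal \<Rightarrow> 'd signal \<Rightarrow> bool" where
  "has_fourier_L2 f F \<longleftrightarrow> f \<in> L2 \<and> F \<in> L2 \<and>
     (\<exists>s. (\<forall>n. s n \<in> L1 \<inter> L2) \<and>
          (\<lambda>n::nat. L2_norm (\<lambda>x. s n x - f x)) \<longlonglongrightarrow> 0 \<and>
          (\<lambda>n. L2_norm (\<lambda>\<omega>. fourier_L1 (s n) \<omega> - F \<omega>)) \<longlonglongrightarrow> 0)"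

text \<open>The support of a function given up to null sets: the complement of the largest open set on
  which the function vanishes almost everywhere.\<close>

definition ess_support :: "'d::finite signal \<Rightarrow> (real ^ 'd) set" where
  "ess_support F = - \<Union>{V. open V \<and> (AE x in lborel. x \<in> V \<longrightarrow> F x = 0)}"

definition L2_band :: "real \<Rightarrow> 'd::finite signal set" where
  "L2_band R = {f \<in> L2. \<exists>F. has_fourier_L2 f F \<and> ess_support F \<subseteq> ball 0 R}"


section \<open>Deformations\<close>

definition C1_map :: "(real ^ 'd::finite \<Rightarrow> real ^ 'd) \<Rightarrow> bool" where
  "C1_map \<tau> \<longleftrightarrow> (\<forall>x. \<tau> differentiable (at x)) \<and> continuous_on UNIV (\<lambda>x. jacobian \<tau> (at x))"

definition sup_norm :: "('a \<Rightarrow> 'b::real_normed_vector) \<Rightarrow> ennreal" where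
  "sup_norm h = (SUP x. ennreal (norm (h x)))"

definition jacobian_sup_norm :: "(real ^ 'd::finite \<Rightarrow> real ^ 'd) \<Rightarrow> ennreal" where
  "jacobian_sup_norm \<tau> = (SUP x. SUP i. SUP j. ennreal \<bar>jacobian \<tau> (at x) $ i $ j\<bar>)"

definition deformation ::
    "(real ^ 'd::finite \<Rightarrow> real ^ 'd) \<Rightarrow> (real ^ 'd \<Rightarrow> real) \<Rightarrow> 'd signal \<Rightarrow> 'd signal" where
  "deformation \<tau> \<omega> f = (\<lambda>x. exp (2 * complex_of_real pi * \<i> * complex_of_real (\<omega> x)) * f (x - \<tau> x))"


section \<open>Semi-discrete frames and module-sequences\<close>

text \<open>Countable index sets are rendered as (finite or infinite) sets of natural numbers, which is
  no restriction up to relabelling.\<close>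

definition semi_discrete_frame ::
    "nat set \<Rightarrow> (nat \<Rightarrow> 'd::finite signal) \<Rightarrow> real \<Rightarrow> real \<Rightarrow> bool" where
  "semi_discrete_frame \<Lambda> g A B \<longleftrightarrow>
     A > 0 \<and> B > 0 \<and> (\<forall>k\<in>\<Lambda>. g k \<in> L1 \<inter> L2) \<and>
     (\<forall>f\<in>L2.
        ennreal A * (L2_norm f)\<^sup>2
          \<le> (\<Sum>\<^sub>\<infinity>k\<in>\<Lambda>. \<integral>\<^sup>+ b. ennreal ((cmod (L2_inner f (translation b (involution (g k)))))\<^sup>2) \<partial>lborel) \<and>
        (\<Sum>\<^sub>\<infinity>k\<in>\<Lambda>. \<integral>\<^sup>+ b. ennreal ((cmod (L2_inner f (translation b (involution (g k)))))\<^sup>2) \<partial>lborel)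
          \<le> ennreal B * (L2_norm f)\<^sup>2)"

lemma L2_inner_translation_involution:
  "L2_inner f (translation b (involution g)) = convolution f g b"
  by (simp add: L2_inner_def translation_def involution_def convolution_def)

lemma frame_sum_eq_convolution_sum:
  "(\<Sum>\<^sub>\<infinity>k\<in>\<Lambda>. \<integral>\<^sup>+ b. ennreal ((cmod (L2_inner f (translation b (involution (g k)))))\<^sup>2) \<partial>lborel)
     = (\<Sum>\<^sub>\<infinity>k\<in>\<Lambda>. (L2_norm (convolution f (g k)))\<^sup>2)"
  by (simp add: L2_inner_translation_involution L2_norm_def)

text \<open>Being Lipschitz and fixing zero is only required up to null sets and only on \<open>L2\<close>.\<close>

definition lipschitz_L2_operator :: "real \<Rightarrow> ('d::finite signal \<Rightarrow> 'd signal) \<Rightarrow> bool" where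
  "lipschitz_L2_operator K T \<longleftrightarrow>
     K > 0 \<and> (\<forall>f\<in>L2. T f \<in> L2) \<and>
     (\<forall>f\<in>L2. \<forall>h\<in>L2. L2_norm (\<lambda>x. T f x - T h x) \<le> ennreal K * L2_norm (\<lambda>x. f x - h x)) \<and>
     (AE x in lborel. T (\<lambda>_. 0) x = 0)"

text \<open>The layers are numbered \<open>1, 2, \<dots>\<close>; the values of the fields at \<open>0\<close> are irrelevant. The
  constants on which admissibility depends are part of the data: \<open>frame_bound\<close> is the upper frame
  bound, \<open>nonlin_lip\<close> and \<open>pool_lip\<close> the Lipschitz constants of the two operators.\<close>

record 'd module_seq =
  indices     :: "nat \<Rightarrow> nat set"
  atom        :: "nat \<Rightarrow> nat \<Rightarrow> 'd signal"
  out_index   :: "nat \<Rightarrow> nat"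
  nonlin      :: "nat \<Rightarrow> 'd signal \<Rightarrow> 'd signal"
  pool        :: "nat \<Rightarrow> 'd signal \<Rightarrow> 'd signal"
  pool_factor :: "nat \<Rightarrow> real"
  frame_bound :: "nat \<Rightarrow> real"
  nonlin_lip  :: "nat \<Rightarrow> real"
  pool_lip    :: "nat \<Rightarrow> real"

definition module_sequence :: "'d::finite module_seq \<Rightarrow> bool" where
  "module_sequence \<Omega> \<longleftrightarrow>
     (\<forall>n\<ge>1.
        (\<exists>A. semi_discrete_frame (indices \<Omega> n) (atom \<Omega> n) A (frame_bound \<Omega> n)) \<and>
        out_index \<Omega> n \<in> indices \<Omega> n \<and>
        lipschitz_L2_operator (nonlin_lip \<Omega> n) (nonlin \<Omega> n) \<and>
        lipschitz_L2_operator (pool_lip \<Omega> n) (pool \<Omega> n) \<and>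
        pool_factor \<Omega> n \<ge> 1)"

definition admissible :: "'d::finite module_seq \<Rightarrow> bool" where
  "admissible \<Omega> \<longleftrightarrow>
     (\<forall>n\<ge>1. max (frame_bound \<Omega> n)
                 (frame_bound \<Omega> n * (nonlin_lip \<Omega> n)\<^sup>2 * (pool_lip \<Omega> n)\<^sup>2) \<le> 1)"


section \<open>The network and its feature extractor\<close>

definition layer_op ::
    "'d::finite module_seq \<Rightarrow> nat \<Rightarrow> nat \<Rightarrow> 'd signal \<Rightarrow> 'd signal" where
  "layer_op \<Omega> n k f = (\<lambda>x.
     complex_of_real (pool_factor \<Omega> n powr (real CARD('d) / 2)) *
     pool \<Omega> n (nonlin \<Omega> n (convolution f (atom \<Omega> n k))) (pool_factor \<Omega> n *\<^sub>R x))"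

text \<open>A path \<open>(\<lambda>\<^sub>1, \<dots>, \<lambda>\<^sub>n)\<close> is a list; the entry at (zero-based) position \<open>i\<close> belongs to layer
  \<open>i + 1\<close>.\<close>

definition paths_of_length :: "'d::finite module_seq \<Rightarrow> nat \<Rightarrow> nat list set" where
  "paths_of_length \<Omega> n =
     {q. length q = n \<and> (\<forall>i<n. q ! i \<in> indices \<Omega> (i + 1) - {out_index \<Omega> (i + 1)})}"

definition paths :: "'d::finite module_seq \<Rightarrow> nat list set" where
  "paths \<Omega> = (\<Union>n. paths_of_length \<Omega> n)"

text \<open>\<open>path_op_from \<Omega> n q\<close> applies the entries of \<open>q\<close> from left to right in the layers
  \<open>n, n + 1, \<dots>\<close>.\<close>

primrec path_op_from ::
    "'d::finite module_seq \<Rightarrow> nat \<Rightarrow> nat list \<Rightarrow> 'd signal \<Rightarrow> 'd signal" where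
  "path_op_from \<Omega> n [] f = f"
| "path_op_from \<Omega> n (k # q) f = path_op_from \<Omega> (n + 1) q (layer_op \<Omega> n k f)"

definition path_op :: "'d::finite module_seq \<Rightarrow> nat list \<Rightarrow> 'd signal \<Rightarrow> 'd signal" where
  "path_op \<Omega> q = path_op_from \<Omega> 1 q"

definition out_atom :: "'d::finite module_seq \<Rightarrow> nat \<Rightarrow> 'd signal" where
  "out_atom \<Omega> n = atom \<Omega> (n + 1) (out_index \<Omega> (n + 1))"

text \<open>The feature extractor as a family indexed by \<open>paths \<Omega>\<close>; values at other lists are never
  used.\<close>

definition features :: "'d::finite module_seq \<Rightarrow> 'd signal \<Rightarrow> nat list \<Rightarrow> 'd signal" where
  "features \<Omega> f q = convolution (path_op \<Omega> q f) (out_atom \<Omega> (length q))"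

definition family_norm :: "'d::finite module_seq \<Rightarrow> (nat list \<Rightarrow> 'd signal) \<Rightarrow> ennreal" where
  "family_norm \<Omega> s = ennreal_sqrt (\<Sum>\<^sub>\<infinity>q\<in>paths \<Omega>. (L2_norm (s q))\<^sup>2)"

end

(*
  The feature extractor is nonexpansive: in each layer the frame inequality together with
  admissibility shows that the energy emitted by the output atom plus the energy passed on to the
  next layer is at most the energy of the input, for differences of signals as well.

  It remains to bound |F f - f|_2. The modulation contributes at most 2 pi |omega|_oo. For the
  displacement, f agrees almost everywhere with the inverse Fourier integral f0 of its transform,
  which is supported in the ball of radius R. Along the segment from x to x - tau(x), the
  fundamental theorem of calculus bounds f0(x - tau(x)) - f0(x) by |tau|_oo times the average over t
  of |grad f0|(x - t tau(x)). The map x - t tau(x) shrinks distances by at most a factor 2, so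
  composition with it is bounded on L2, and |grad f0|_2 is controlled by R |f|_2 through
  Plancherel's inequality.

  Only the inequality half of Plancherel's theorem is needed; it follows by Gaussian regularisation
  on L1, and a crude passage to the L2 limit costs a constant factor. The identity f = f0 follows by
  duality from the injectivity of the Fourier transform on L1.
*)

theory Submission
  imports Defs "HOL-Probability.Characteristic_Functions"
begin

section \<open>Lebesgue measure under affine and expanding maps\<close>

text \<open>The composite \<open>f (x - \<tau> x)\<close> must make sense for a signal known only up
  to null sets, and its energy must be controlled for every intermediate map
  \<open>x - t *\<^sub>R \<tau> x\<close>. Both rest on one metric fact: a Borel map that at most
  halves distances pulls a Borel set of measure m back to a set of measure at most 4^d m. This
  replaces a change of variables with its determinant. The bound 1/(2d) on the Jacobian entries is
  what makes \<open>\<tau>\<close> a contraction by 1/2.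

  The gradient of f0 never appears as a derivative. The fundamental theorem of calculus is applied
  to a single character and then integrated over the frequencies, so partial derivatives enter only
  as Fourier integrals of the multiplied transform.

  Estimates are made for squared norms in \<open>ennreal\<close>. Infinite sup norms then need no
  separate case, and a triangle inequality with factor 2 can stand in for Minkowski's inequality,
  since only some constant is asked for. The operators of a layer are nonlinear, so the network is
  always compared at two signals; only convolution is linear.\<close>

lemma nn_integral_lborel_affine:
  fixes h :: "'a::euclidean_space \<Rightarrow> ennreal"
  assumes [measurable]: "h \<in> borel_measurable borel" and c: "c \<noteq> 0"
  shows "(\<integral>\<^sup>+x. h x \<partial>lborel) = ennreal (\<bar>c\<bar> ^ DIM('a)) * (\<integral>\<^sup>+x. h (t + c *\<^sub>R x) \<partial>lborel)"
  by (subst lborel_affine[OF c, of t])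
     (simp add: nn_integral_density nn_integral_distr nn_integral_cmult)

lemma integrable_lborel_affine:
  fixes h :: "'a::euclidean_space \<Rightarrow> 'b::{banach, second_countable_topology}"
  assumes h: "integrable lborel h" and c: "c \<noteq> 0"
  shows "integrable lborel (\<lambda>x. h (t + c *\<^sub>R x))"
proof -
  have [measurable]: "h \<in> borel_measurable borel" using h by auto
  have "integrable (density (distr lborel borel (\<lambda>x. t + c *\<^sub>R x)) (\<lambda>_. \<bar>c\<bar>^DIM('a))) h"
    using h lborel_affine[OF c, of t] by simp
  then have "integrable lborel (\<lambda>x. (\<bar>c\<bar> ^ DIM('a)) *\<^sub>R h (t + c *\<^sub>R x))"
    by (simp add: integrable_density integrable_distr_eq)
  from integrable_scaleR_right[OF this, of "inverse (\<bar>c\<bar> ^ DIM('a))"] c show ?thesis by simp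
qed

lemma integral_lborel_affine:
  fixes h :: "'a::euclidean_space \<Rightarrow> 'b::{banach, second_countable_topology}"
  assumes [measurable]: "h \<in> borel_measurable borel" and c: "c \<noteq> 0"
  shows "(\<integral>x. h x \<partial>lborel) = (\<bar>c\<bar> ^ DIM('a)) *\<^sub>R (\<integral>x. h (t + c *\<^sub>R x) \<partial>lborel)"
  by (subst lborel_affine[OF c, of t]) (simp add: integral_density integral_distr)

lemma nn_integral_lborel_shift:
  fixes h :: "'a::euclidean_space \<Rightarrow> ennreal"
  assumes "h \<in> borel_measurable borel"
  shows "(\<integral>\<^sup>+x. h (x - t) \<partial>lborel) = (\<integral>\<^sup>+x. h x \<partial>lborel)"
  using nn_integral_lborel_affine[OF assms, of 1 "-t"] by (simp add: algebra_simps)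

lemma nn_integral_lborel_reflect:
  fixes h :: "'a::euclidean_space \<Rightarrow> ennreal"
  assumes "h \<in> borel_measurable borel"
  shows "(\<integral>\<^sup>+x. h (t - x) \<partial>lborel) = (\<integral>\<^sup>+x. h x \<partial>lborel)"
  using nn_integral_lborel_affine[OF assms, of "-1" t] by simp

lemma integral_lborel_shift:
  fixes h :: "'a::euclidean_space \<Rightarrow> 'b::{banach, second_countable_topology}"
  assumes "h \<in> borel_measurable borel"
  shows "(\<integral>x. h (x - t) \<partial>lborel) = (\<integral>x. h x \<partial>lborel)"
  using integral_lborel_affine[OF assms, of 1 "-t"] by (simp add: algebra_simps)

lemma integral_lborel_reflect:
  fixes h :: "'a::euclidean_space \<Rightarrow> 'b::{banach, second_countable_topology}"
  assumes "h \<in> borel_measurable borel"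
  shows "(\<integral>x. h (- x) \<partial>lborel) = (\<integral>x. h x \<partial>lborel)"
  using integral_lborel_affine[OF assms, of "-1" 0] by simp

text \<open>Averaging the indicator of an open set \<open>U\<close> over balls of radius \<open>r\<close> and letting \<open>r\<close> tend to
  \<open>0\<close> reduces the claim to preimages of balls, which lie in balls of four times the radius.\<close>

lemma emeasure_vimage_expanding_open:
  fixes G :: "'a::euclidean_space \<Rightarrow> 'a"
  assumes G[measurable]: "G \<in> borel_measurable borel"
    and expand: "\<And>x y. dist x y \<le> 2 * dist (G x) (G y)"
    and U: "open U"
  shows "emeasure lborel (G -` U) \<le> ennreal (4 ^ DIM('a)) * emeasure lborel U"
proof -
  have [measurable]: "U \<in> sets borel" using U by auto
  define v where "v r = ennreal (unit_ball_vol (DIM('a)) * r ^ DIM('a))" for r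
  have v: "emeasure lborel (ball c r) = v r" if "r \<ge> 0" for c :: 'a and r
    using that by (simp add: v_def emeasure_ball)
  have v4: "v (4 * r) = ennreal (4 ^ DIM('a)) * v r" if "r \<ge> 0" for r
    using that by (simp add: v_def power_mult_distrib ennreal_mult[symmetric] mult_ac)
  have v_fin: "v r \<noteq> top" "r > 0 \<Longrightarrow> v r > 0" for r
    by (auto simp: v_def)
  \<comment> \<open>Two points of the preimage have images less than \<open>2 * r\<close> apart, so
    they are themselves less than \<open>4 * r\<close> apart, and any point of the preimage can
    serve as centre. This is the origin of \<open>4 ^ DIM('a)\<close>.\<close>
  have pre: "emeasure lborel {x. dist (G x) a < r} \<le> ennreal (4 ^ DIM('a)) * v r" if r: "r > 0" for a r
  proof (cases "{x. dist (G x) a < r} = {}")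
    case False
    then obtain x0 where x0: "dist (G x0) a < r" by auto
    have "{x. dist (G x) a < r} \<subseteq> ball x0 (4 * r)"
    proof
      fix x assume "x \<in> {x. dist (G x) a < r}"
      then have "dist (G x0) (G x) < 2 * r"
        using x0 dist_triangle2[of "G x0" "G x" a] by (simp add: dist_commute)
      then show "x \<in> ball x0 (4 * r)" using expand[of x0 x] by simp
    qed
    then have "emeasure lborel {x. dist (G x) a < r} \<le> emeasure lborel (ball x0 (4 * r))"
      by (intro emeasure_mono) auto
    then show ?thesis using r by (simp add: v v4)
  qed auto
  \<comment> \<open>The mean of the indicator of \<open>U\<close> over the ball of radius
    \<open>r\<close> about \<open>y\<close>. Taken at \<open>y = G x\<close> and integrated over
    \<open>x\<close>, it becomes by Fubini an average of measures of preimages of balls centred in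
    \<open>U\<close>.\<close>
  define \<beta> where "\<beta> r y = (\<integral>\<^sup>+a. indicator U a * indicator (ball y r) a \<partial>lborel) / v r" for r and y :: 'a
  have ball_meas[measurable]: "(\<lambda>(x, a). indicator (ball (G x) r) a :: ennreal) \<in> borel_measurable (borel \<Otimes>\<^sub>M borel)" for r
  proof -
    have "(\<lambda>(x, a). indicator (ball (G x) r) a :: ennreal) = (\<lambda>p. indicator {p. dist (G (fst p)) (snd p) < r} p)"
      by (auto simp: fun_eq_iff indicator_def)
    then show ?thesis by simp
  qed
  have [measurable]: "(\<lambda>x. \<beta> r (G x)) \<in> borel_measurable lborel" for r
    unfolding \<beta>_def by measurable
  have \<beta>_int: "(\<integral>\<^sup>+x. \<beta> r (G x) \<partial>lborel) \<le> ennreal (4 ^ DIM('a)) * emeasure lborel U" if r: "r > 0" for r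
  proof -
    have "(\<integral>\<^sup>+x. \<beta> r (G x) \<partial>lborel) = (\<integral>\<^sup>+x. (\<integral>\<^sup>+a. indicator U a * indicator (ball (G x) r) a \<partial>lborel) \<partial>lborel) / v r"
      unfolding \<beta>_def by (rule nn_integral_divide) measurable
    also have "(\<integral>\<^sup>+x. (\<integral>\<^sup>+a. indicator U a * indicator (ball (G x) r) a \<partial>lborel) \<partial>lborel)
        = (\<integral>\<^sup>+a. (\<integral>\<^sup>+x. indicator U a * indicator (ball (G x) r) a \<partial>lborel) \<partial>lborel)"
      by (rule lborel_pair.Fubini') measurable
    also have "\<dots> = (\<integral>\<^sup>+a. indicator U a * emeasure lborel {x. dist (G x) a < r} \<partial>lborel)"
    proof (rule nn_integral_cong)
      fix a
      have "(\<integral>\<^sup>+x. indicator U a * indicator (ball (G x) r) a \<partial>lborel)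
          = (\<integral>\<^sup>+x. indicator U a * indicator {x. dist (G x) a < r} x \<partial>lborel)"
        by (intro nn_integral_cong) (auto simp: indicator_def)
      then show "(\<integral>\<^sup>+x. indicator U a * indicator (ball (G x) r) a \<partial>lborel) = indicator U a * emeasure lborel {x. dist (G x) a < r}"
        by (simp add: nn_integral_cmult)
    qed
    also have "\<dots> \<le> (\<integral>\<^sup>+a. (ennreal (4 ^ DIM('a)) * v r) * indicator U a \<partial>lborel)"
      using pre[OF r] by (intro nn_integral_mono) (auto simp: indicator_def)
    also have "\<dots> = (ennreal (4 ^ DIM('a)) * emeasure lborel U) * v r"
      by (subst nn_integral_cmult_indicator) (auto simp: mult_ac)
    finally have "(\<integral>\<^sup>+x. \<beta> r (G x) \<partial>lborel) \<le> (ennreal (4 ^ DIM('a)) * emeasure lborel U) * v r / v r"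
      by (simp add: divide_right_mono_ennreal)
    then show ?thesis using v_fin[of r] r by (simp add: ennreal_mult_divide_eq)
  qed
  \<comment> \<open>Small balls about a point \<open>G x\<close> of the open set \<open>U\<close>
    lie inside \<open>U\<close>, so there the means are eventually equal to 1; elsewhere the
    left-hand side is 0. This lower bound is the form that Fatou's lemma asks for.\<close>
  have lim: "indicator (G -` U) x \<le> liminf (\<lambda>n. \<beta> (1 / real (Suc n)) (G x))" for x
  proof (cases "G x \<in> U")
    case True
    then obtain e where e: "e > 0" "ball (G x) e \<subseteq> U" using U open_contains_ball by blast
    have "eventually (\<lambda>n. \<beta> (1 / real (Suc n)) (G x) = 1) sequentially"
    proof -
      have "eventually (\<lambda>n. 1 / real (Suc n) < e) sequentially"
        by (rule order_tendstoD(2)[OF _ e(1)]) (use lim_1_over_n LIMSEQ_Suc in force)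
      then show ?thesis
      proof eventually_elim
        case (elim n)
        let ?r = "1 / real (Suc n)"
        have "ball (G x) ?r \<subseteq> U" using elim e by auto
        then have "(\<integral>\<^sup>+a. indicator U a * indicator (ball (G x) ?r) a \<partial>lborel) = (\<integral>\<^sup>+a. indicator (ball (G x) ?r) a \<partial>lborel)"
          by (intro nn_integral_cong) (auto simp: indicator_def)
        also have "\<dots> = v ?r" by (simp add: v del: of_nat_Suc)
        finally show ?case using v_fin[of ?r] by (simp add: \<beta>_def ennreal_divide_self less_top del: of_nat_Suc)
      qed
    qed
    then have "(\<lambda>n. \<beta> (1 / real (Suc n)) (G x)) \<longlonglongrightarrow> 1"
      by (rule tendsto_eventually)
    then show ?thesis using True by (simp add: lim_imp_Liminf)
  qed auto
  have "emeasure lborel (G -` U) = (\<integral>\<^sup>+x. indicator (G -` U) x \<partial>lborel)"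
    using measurable_sets[OF G, of U] by simp
  also have "\<dots> \<le> (\<integral>\<^sup>+x. liminf (\<lambda>n. \<beta> (1 / real (Suc n)) (G x)) \<partial>lborel)"
    by (intro nn_integral_mono lim)
  also have "\<dots> \<le> liminf (\<lambda>n. \<integral>\<^sup>+x. \<beta> (1 / real (Suc n)) (G x) \<partial>lborel)"
    by (rule nn_integral_liminf) measurable
  also have "\<dots> \<le> ennreal (4 ^ DIM('a)) * emeasure lborel U"
    by (rule Liminf_le) (auto intro!: always_eventually \<beta>_int simp del: of_nat_Suc)
  finally show ?thesis .
qed

text \<open>Outer regularity carries the bound from open sets to Borel sets, and induction over
  nonnegative Borel functions carries it to integrals.\<close>

lemma nn_integral_expanding_le:
  fixes G :: "'a::euclidean_space \<Rightarrow> 'a"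
  assumes G[measurable]: "G \<in> borel_measurable borel"
    and expand: "\<And>x y. dist x y \<le> 2 * dist (G x) (G y)"
    and h: "h \<in> borel_measurable borel"
  shows "(\<integral>\<^sup>+x. h (G x) \<partial>lborel) \<le> ennreal (4 ^ DIM('a)) * (\<integral>\<^sup>+x. h x \<partial>lborel)"
  using h
proof (induction rule: borel_measurable_induct)
  case (cong f g)
  then show ?case by (simp add: fun_eq_iff[symmetric])
next
  case (set A)
  then have A[measurable]: "A \<in> sets borel" by simp
  have "emeasure lborel (G -` A) \<le> ennreal (4 ^ DIM('a)) * emeasure lborel A"
  proof (rule ennreal_le_epsilon)
    fix e :: real assume "0 < e"
    \<comment> \<open>The excess is divided by \<open>4 ^ DIM('a)\<close> because the bound for
      \<open>U\<close> multiplies it by that factor.\<close>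
    obtain U where U: "open U" "A \<subseteq> U" "emeasure lborel (U - A) < ennreal (e / 4 ^ DIM('a))"
      using outer_regular_lborel[OF A, of "e / 4 ^ DIM('a)"] \<open>0 < e\<close> by auto
    have [measurable]: "U \<in> sets borel" using U by auto
    have "emeasure lborel (G -` A) \<le> emeasure lborel (G -` U)"
      using U measurable_sets[OF G, of U] by (intro emeasure_mono) auto
    also have "\<dots> \<le> ennreal (4 ^ DIM('a)) * emeasure lborel U"
      by (rule emeasure_vimage_expanding_open[OF G expand U(1)])
    also have "emeasure lborel U = emeasure lborel A + emeasure lborel (U - A)"
      using U(2) plus_emeasure[of A lborel "U - A"] by (simp add: Un_absorb1)
    also have "\<dots> \<le> emeasure lborel A + ennreal (e / 4 ^ DIM('a))"
      using U(3) by (intro add_left_mono) auto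
    also have "ennreal (4 ^ DIM('a)) * (emeasure lborel A + ennreal (e / 4 ^ DIM('a)))
       = ennreal (4 ^ DIM('a)) * emeasure lborel A + ennreal e"
      using \<open>0 < e\<close> by (simp add: distrib_left ennreal_mult[symmetric])
    finally show "emeasure lborel (G -` A) \<le> ennreal (4 ^ DIM('a)) * emeasure lborel A + ennreal e"
      by (simp add: mult_left_mono)
  qed
  moreover have "(\<integral>\<^sup>+x. indicator A (G x) \<partial>lborel) = emeasure lborel (G -` A)"
    using measurable_sets[OF G, of A] by (simp add: indicator_vimage[symmetric])
  ultimately show ?case by simp
next
  case (mult u c)
  have [measurable]: "u \<in> borel_measurable borel" using mult by simp
  show ?case
    using mult_left_mono[OF mult.IH, of c] by (simp add: nn_integral_cmult mult_ac)
next
  case (add u v)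
  have [measurable]: "u \<in> borel_measurable borel" "v \<in> borel_measurable borel" using add by simp_all
  show ?case
    using add_mono[OF add.IH] by (simp add: nn_integral_add distrib_left add_ac)
next
  case (seq U)
  have [measurable]: "\<And>i. U i \<in> borel_measurable borel" using seq by simp
  have inc: "incseq (\<lambda>i x. U i (G x))" using seq(3) by (auto simp: incseq_def le_fun_def)
  have "(\<integral>\<^sup>+x. (SUP i. U i) (G x) \<partial>lborel) = (SUP i. \<integral>\<^sup>+x. U i (G x) \<partial>lborel)"
    using inc by (simp add: image_comp nn_integral_monotone_convergence_SUP)
  also have "\<dots> \<le> (SUP i. ennreal (4 ^ DIM('a)) * (\<integral>\<^sup>+x. U i x \<partial>lborel))"
    by (intro SUP_mono) (use seq in auto)
  also have "\<dots> = ennreal (4 ^ DIM('a)) * (\<integral>\<^sup>+x. (SUP i. U i x) \<partial>lborel)"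
    using seq(3) by (simp add: SUP_mult_left_ennreal nn_integral_monotone_convergence_SUP)
  finally show ?case by (simp add: image_comp)
qed

section \<open>The Fourier transform of a Gaussian\<close>

text \<open>The factor \<open>pi\<close> in the exponent makes \<open>gaussian 1\<close> its own
  Fourier transform.\<close>

definition gaussian :: "real \<Rightarrow> 'a::euclidean_space \<Rightarrow> real" where
  "gaussian a x = exp (- (pi * a * (norm x)\<^sup>2))"

text \<open>The character with positive sign: the Fourier transform pairs with
  \<open>wave \<xi> (- x)\<close>, its inverse with \<open>wave \<xi> x\<close>.\<close>

definition wave :: "'a::euclidean_space \<Rightarrow> 'a \<Rightarrow> complex" where
  "wave \<xi> x = cis (2 * pi * (\<xi> \<bullet> x))"

lemma gaussian_pos [simp]: "0 < gaussian a x" "0 \<le> gaussian a x" "gaussian a x \<noteq> 0"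
  by (simp_all add: gaussian_def)

lemma gaussian_le_1: "a \<ge> 0 \<Longrightarrow> gaussian a x \<le> 1"
  by (simp add: gaussian_def)

lemma gaussian_minus [simp]: "gaussian a (- x) = gaussian a x"
  by (simp add: gaussian_def)

lemma gaussian_commute: "gaussian a (x - y) = gaussian a (y - x)"
  by (simp add: gaussian_def norm_minus_commute)

lemma borel_measurable_gaussian [measurable]:
  "gaussian a \<in> borel_measurable (borel :: 'a::euclidean_space measure)"
  unfolding gaussian_def[abs_def] by measurable

lemma norm_wave [simp]: "cmod (wave \<xi> x) = 1"
  by (simp add: wave_def)

lemma continuous_on_wave: "continuous_on UNIV (\<lambda>p. wave (fst p) (snd p))"
  unfolding wave_def by (intro continuous_intros)

lemma borel_measurable_wave [measurable (raw)]:
  assumes [measurable]: "f \<in> borel_measurable M" "g \<in> borel_measurable M"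
  shows "(\<lambda>x. wave (f x) (g x)) \<in> borel_measurable M"
  using borel_measurable_continuous_on[OF continuous_on_wave, of "\<lambda>x. (f x, g x)" M]
  by (simp add: borel_prod)

lemma wave_add: "wave \<xi> (x + y) = wave \<xi> x * wave \<xi> y"
  by (simp add: wave_def inner_add_right distrib_left cis_mult)

lemma wave_minus: "wave (- \<xi>) x = wave \<xi> (- x)"
  by (simp add: wave_def)

lemma cnj_wave: "cnj (wave \<xi> x) = wave \<xi> (- x)"
  by (simp add: wave_def cis_cnj)

lemma fourier_L1_wave: "fourier_L1 f \<xi> = (\<integral>x. f x * wave \<xi> (- x) \<partial>lborel)"
proof -
  have "exp (- (2 * complex_of_real pi * \<i> * complex_of_real (x \<bullet> \<xi>))) = wave \<xi> (- x)" for x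
    unfolding wave_def cis_conv_exp by (simp add: inner_commute mult_ac)
  then show ?thesis by (simp add: fourier_L1_def)
qed

lemma borel_measurable_cis [measurable]: "cis \<in> borel_measurable borel"
  by (intro borel_measurable_continuous_onI continuous_intros)

text \<open>Up to a change of scale this is the characteristic function of the standard normal
  distribution.\<close>

lemma gaussian_fourier_real:
  fixes a \<xi> :: real
  assumes a: "a > 0"
  shows "integrable lborel (\<lambda>x::real. complex_of_real (exp (- (pi * a * x\<^sup>2))) * cis (- (2 * pi * \<xi> * x)))"
    and "(\<integral>(x::real). complex_of_real (exp (- (pi * a * x\<^sup>2))) * cis (- (2 * pi * \<xi> * x)) \<partial>lborel)
       = complex_of_real (1 / sqrt a * exp (- (pi * \<xi>\<^sup>2 / a)))"
proof -
  define k where "k t x = complex_of_real (std_normal_density x) * cis (t * x)" for t x :: real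
  have int_k: "integrable lborel (k t)" for t
  proof -
    have "integrable lborel (\<lambda>x. std_normal_density x)" by (rule integrable_normal_density) simp
    then show ?thesis
      unfolding k_def by (rule Bochner_Integration.integrable_bound) (auto simp: norm_mult)
  qed
  have k_val: "(\<integral>x. k t x \<partial>lborel) = complex_of_real (exp (- (t\<^sup>2) / 2))" for t
  proof -
    have "char std_normal_distribution t = (\<integral>x. std_normal_density x *\<^sub>R iexp (t * x) \<partial>lborel)"
      unfolding char_def by (subst integral_density) auto
    also have "\<dots> = (\<integral>x. k t x \<partial>lborel)"
      by (simp add: k_def cis_conv_exp scaleR_conv_of_real)
    finally show ?thesis by (simp add: char_std_normal_distribution)
  qed
  \<comment> \<open>The scale \<open>c\<close> turns \<open>(c * x)^2 / 2\<close> into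
    \<open>pi * a * x^2\<close>, and \<open>t\<close> is then fixed by
    \<open>t * c = - (2 * pi * \<xi>)\<close>.\<close>
  define c where "c = sqrt (2 * pi * a)"
  have c: "c > 0" "c\<^sup>2 = 2 * pi * a" using a by (auto simp: c_def)
  define t where "t = - (2 * pi * \<xi>) / c"
  have eq: "complex_of_real (exp (- (pi * a * x\<^sup>2))) * cis (- (2 * pi * \<xi> * x))
      = complex_of_real (sqrt (2 * pi)) * k t (0 + c * x)" for x
  proof -
    have "(c * x)\<^sup>2 / 2 = pi * a * x\<^sup>2" using c by (simp add: power_mult_distrib)
    moreover have "t * (c * x) = - (2 * pi * \<xi> * x)" using c by (simp add: t_def)
    ultimately show ?thesis
      by (simp add: k_def std_normal_density_def)
  qed
  show "integrable lborel (\<lambda>x::real. complex_of_real (exp (- (pi * a * x\<^sup>2))) * cis (- (2 * pi * \<xi> * x)))"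
    unfolding eq using lborel_integrable_real_affine[OF int_k[of t], of c 0] c
    by (intro integrable_mult_right) auto
  have "(\<integral>x. k t x \<partial>lborel) = c *\<^sub>R (\<integral>x. k t (0 + c * x) \<partial>lborel)"
    using lborel_integral_real_affine[of c "k t" 0] c by simp
  then have "(\<integral>x. k t (0 + c * x) \<partial>lborel) = complex_of_real (exp (- (t\<^sup>2) / 2) / c)"
    using c by (simp add: k_val scaleR_conv_of_real field_simps)
  moreover have "t\<^sup>2 / 2 = pi * \<xi>\<^sup>2 / a"
    using c a by (simp add: t_def power_divide power_mult_distrib power2_eq_square)
  moreover have "sqrt (2 * pi) / c = 1 / sqrt a"
    using a by (simp add: c_def real_sqrt_mult)
  ultimately have "complex_of_real (sqrt (2 * pi)) * (\<integral>x. k t (0 + c * x) \<partial>lborel)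
     = complex_of_real (1 / sqrt a * exp (- (pi * \<xi>\<^sup>2 / a)))"
    by (simp add: of_real_divide[symmetric] of_real_mult[symmetric] del: of_real_divide of_real_mult)
      (metis times_divide_eq_left times_divide_eq_right mult.commute mult_1)
  then show "(\<integral>(x::real). complex_of_real (exp (- (pi * a * x\<^sup>2))) * cis (- (2 * pi * \<xi> * x)) \<partial>lborel)
       = complex_of_real (1 / sqrt a * exp (- (pi * \<xi>\<^sup>2 / a)))"
    unfolding eq by simp
qed

text \<open>\<open>lborel\<close> is the image of the product of one-dimensional Lebesgue measures
  under the coordinate map, so Fubini can be applied one coordinate at a time.\<close>

lemma integral_lborel_prod:
  fixes f :: "'a::euclidean_space \<Rightarrow> real \<Rightarrow> complex"
  assumes f: "\<And>b. b \<in> Basis \<Longrightarrow> integrable lborel (f b)"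
  shows "integrable lborel (\<lambda>x::'a. \<Prod>b\<in>Basis. f b (x \<bullet> b))"
    and "(\<integral>(x::'a). (\<Prod>b\<in>Basis. f b (x \<bullet> b)) \<partial>lborel) = (\<Prod>b\<in>Basis. \<integral>x. f b x \<partial>lborel)"
proof -
  interpret product_sigma_finite "\<lambda>b::'a. lborel :: real measure" ..
  have [measurable]: "f b \<in> borel_measurable borel" if "b \<in> Basis" for b using f[OF that] by auto
  have eq: "(\<Prod>b\<in>Basis. f b ((\<Sum>b'\<in>Basis. g b' *\<^sub>R b') \<bullet> b)) = (\<Prod>b\<in>Basis. f b (g b))" for g
    by (intro prod.cong refl) (simp add: inner_sum_left inner_Basis if_distrib sum.delta cong: if_cong)
  show "integrable lborel (\<lambda>x::'a. \<Prod>b\<in>Basis. f b (x \<bullet> b))"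
    unfolding lborel_eq[where 'a='a]
    by (subst integrable_distr_eq) (auto simp: eq intro!: product_integrable_prod f)
  show "(\<integral>(x::'a). (\<Prod>b\<in>Basis. f b (x \<bullet> b)) \<partial>lborel) = (\<Prod>b\<in>Basis. \<integral>x. f b x \<partial>lborel)"
    unfolding lborel_eq[where 'a='a]
    by (subst integral_distr) (auto simp: eq intro!: product_integral_prod f)
qed

text \<open>Both the Gaussian and the character factor over the coordinates.\<close>

lemma gaussian_fourier:
  fixes \<xi> :: "'a::euclidean_space"
  assumes a: "a > 0"
  shows "integrable lborel (\<lambda>x::'a. complex_of_real (gaussian a x) * wave \<xi> (- x))"
    and "(\<integral>(x::'a). complex_of_real (gaussian a x) * wave \<xi> (- x) \<partial>lborel)
       = complex_of_real ((1 / sqrt a) ^ DIM('a) * gaussian (1 / a) \<xi>)"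
proof -
  define f where "f b x = complex_of_real (exp (- (pi * a * x\<^sup>2))) * cis (- (2 * pi * (\<xi> \<bullet> b) * x))" for b x
  have eq: "complex_of_real (gaussian a x) * wave \<xi> (- x) = (\<Prod>b\<in>Basis. f b (x \<bullet> b))" for x
  proof -
    have nx: "(norm x)\<^sup>2 = (\<Sum>b\<in>Basis. (x \<bullet> b)\<^sup>2)"
      unfolding power2_norm_eq_inner by (subst euclidean_inner) (simp add: power2_eq_square)
    have 1: "complex_of_real (gaussian a x) = (\<Prod>b\<in>Basis. complex_of_real (exp (- (pi * a * (x \<bullet> b)\<^sup>2))))"
      unfolding gaussian_def nx of_real_prod[symmetric]
      by (simp add: exp_sum[symmetric] sum_negf sum_distrib_left)
    have "wave \<xi> (- x) = (\<Prod>b\<in>Basis. cis (- (2 * pi * (\<xi> \<bullet> b) * (x \<bullet> b))))"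
    proof -
      have "wave \<xi> (- x) = cis (\<Sum>b\<in>Basis. - (2 * pi * (\<xi> \<bullet> b) * (x \<bullet> b)))"
        unfolding wave_def by (subst euclidean_inner) (simp add: sum_distrib_left sum_negf mult_ac)
      then show ?thesis by (simp add: cis_conv_exp exp_sum sum_distrib_left)
    qed
    with 1 show ?thesis by (simp add: f_def prod.distrib)
  qed
  have int: "integrable lborel (f b)" for b
    unfolding f_def by (rule gaussian_fourier_real(1)[OF a])
  show "integrable lborel (\<lambda>x::'a. complex_of_real (gaussian a x) * wave \<xi> (- x))"
    unfolding eq using int by (rule integral_lborel_prod)
  have "(\<integral>(x::'a). complex_of_real (gaussian a x) * wave \<xi> (- x) \<partial>lborel)
     = (\<Prod>b\<in>Basis. \<integral>x. f b x \<partial>lborel)"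
    unfolding eq using int by (rule integral_lborel_prod)
  also have "\<dots> = (\<Prod>b\<in>(Basis::'a set). complex_of_real (1 / sqrt a * exp (- (pi * (\<xi> \<bullet> b)\<^sup>2 / a))))"
    unfolding f_def by (simp only: gaussian_fourier_real(2)[OF a])
  also have "\<dots> = complex_of_real ((1 / sqrt a) ^ DIM('a) * (\<Prod>b\<in>Basis. exp (- (pi * (\<xi> \<bullet> b)\<^sup>2 / a))))"
    by (simp only: of_real_prod[symmetric] prod.distrib prod_constant)
  also have "(\<Prod>b\<in>Basis. exp (- (pi * (\<xi> \<bullet> b)\<^sup>2 / a))) = gaussian (1 / a) \<xi>"
  proof -
    have nx: "(norm \<xi>)\<^sup>2 = (\<Sum>b\<in>Basis. (\<xi> \<bullet> b)\<^sup>2)"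
      unfolding power2_norm_eq_inner by (subst euclidean_inner) (simp add: power2_eq_square)
    show ?thesis
      unfolding gaussian_def nx by (simp add: exp_sum[symmetric] sum_negf sum_distrib_left sum_divide_distrib)
  qed
  finally show "(\<integral>(x::'a). complex_of_real (gaussian a x) * wave \<xi> (- x) \<partial>lborel)
       = complex_of_real ((1 / sqrt a) ^ DIM('a) * gaussian (1 / a) \<xi>)" .
qed

lemma integrable_gaussian:
  assumes "a > 0"
  shows "integrable lborel (gaussian a :: 'a::euclidean_space \<Rightarrow> real)"
proof -
  have "integrable lborel (\<lambda>x::'a. norm (complex_of_real (gaussian a x) * wave 0 (- x)))"
    by (rule integrable_norm[OF gaussian_fourier(1)[OF assms]])
  then show ?thesis by (simp add: norm_mult)
qed

section \<open>Plancherel's inequality and uniqueness\<close>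

text \<open>Working with the square keeps extended square roots out of the estimates;
  \<open>L2_norm\<close> returns only where a final bound is read off.\<close>

definition energy :: "'d::finite signal \<Rightarrow> ennreal" where
  "energy f = (\<integral>\<^sup>+x. ennreal ((cmod (f x))\<^sup>2) \<partial>lborel)"

lemma L2_norm_power2: "(L2_norm f)\<^sup>2 = energy f"
  by (simp add: L2_norm_def energy_def)

lemma L2_borel [measurable_dest]: "f \<in> L2 \<Longrightarrow> f \<in> borel_measurable borel"
  by (simp add: L2_def)

lemma L2_iff_energy: "f \<in> L2 \<longleftrightarrow> f \<in> borel_measurable borel \<and> energy f < top"
  by (auto simp: L2_def energy_def integrable_iff_bounded)

lemma L1_borel [measurable_dest]: "f \<in> L1 \<Longrightarrow> f \<in> borel_measurable borel"
  by (auto simp: L1_def)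

lemma borel_measurable_cnj [measurable]: "cnj \<in> borel_measurable borel"
  by (intro borel_measurable_continuous_onI continuous_intros)

text \<open>The integral of a non-integrable function is 0 by convention, so the bound covers that
  case too and can be used before integrability is known.\<close>

lemma ennreal_norm_integral_le:
  fixes f :: "'a \<Rightarrow> 'b::{banach, second_countable_topology}"
  shows "ennreal (norm (integral\<^sup>L M f)) \<le> (\<integral>\<^sup>+x. norm (f x) \<partial>M)"
  by (cases "integrable M f") (auto simp: integral_norm_bound_ennreal not_integrable_integral_eq)

text \<open>The factors 2 come from \<open>2 * a * b \<le> a^2 + b^2\<close>, applied pointwise to
  the mixed term of the square.\<close>

lemma energy_add_le:
  assumes [measurable]: "f \<in> borel_measurable borel" "g \<in> borel_measurable borel"
  shows "energy (\<lambda>x. f x + g x) \<le> 2 * energy f + 2 * energy g"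
proof -
  have "(cmod (a + b))\<^sup>2 \<le> 2 * (cmod a)\<^sup>2 + 2 * (cmod b)\<^sup>2" for a b
  proof -
    have "(cmod (a + b))\<^sup>2 \<le> (cmod a + cmod b)\<^sup>2"
      by (intro power_mono norm_triangle_ineq) auto
    then show ?thesis using sum_squares_bound[of "cmod a" "cmod b"] by (simp add: power2_sum)
  qed
  from ennreal_leI[OF this]
  have "ennreal ((cmod (a + b))\<^sup>2) \<le> 2 * ennreal ((cmod a)\<^sup>2) + 2 * ennreal ((cmod b)\<^sup>2)" for a b
    by (simp add: ennreal_plus ennreal_mult)
  then have "energy (\<lambda>x. f x + g x) \<le> (\<integral>\<^sup>+x. 2 * ennreal ((cmod (f x))\<^sup>2) + 2 * ennreal ((cmod (g x))\<^sup>2) \<partial>lborel)"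
    unfolding energy_def by (intro nn_integral_mono) auto
  then show ?thesis by (simp add: energy_def nn_integral_add nn_integral_cmult)
qed

lemma energy_diff_le:
  assumes [measurable]: "f \<in> borel_measurable borel" "g \<in> borel_measurable borel"
  shows "energy (\<lambda>x. f x - g x) \<le> 2 * energy f + 2 * energy g"
  using energy_add_le[of f "\<lambda>x. - g x"] by (simp add: energy_def)

lemma L2_diff: "f \<in> L2 \<Longrightarrow> g \<in> L2 \<Longrightarrow> (\<lambda>x. f x - g x) \<in> L2"
proof -
  assume *: "f \<in> L2" "g \<in> L2"
  then have [measurable]: "f \<in> borel_measurable borel" "g \<in> borel_measurable borel" by auto
  have "2 * energy f + 2 * energy g < top"
    using * by (simp add: L2_iff_energy ennreal_mult_less_top)
  with energy_diff_le[of f g] show ?thesis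
    by (simp add: L2_iff_energy order.strict_trans1)
qed

lemma nn_integral_Cauchy_Schwarz_energy:
  assumes [measurable]: "f \<in> borel_measurable borel" "g \<in> borel_measurable borel"
  shows "(\<integral>\<^sup>+x. cmod (f x * g x) \<partial>lborel)\<^sup>2 \<le> energy f * energy g"
  using Cauchy_Schwarz_nn_integral[of "\<lambda>x. ennreal (cmod (f x))" lborel "\<lambda>x. ennreal (cmod (g x))"]
  by (simp add: energy_def norm_mult ennreal_mult ennreal_power)

lemma integrable_L2_mult:
  assumes "f \<in> L2" "g \<in> L2"
  shows "integrable lborel (\<lambda>x. f x * g x)"
proof -
  have [measurable]: "f \<in> borel_measurable borel" "g \<in> borel_measurable borel" using assms by auto
  have "energy f * energy g < top" using assms by (simp add: L2_iff_energy ennreal_mult_less_top)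
  then have "(\<integral>\<^sup>+x. cmod (f x * g x) \<partial>lborel)\<^sup>2 < top"
    using nn_integral_Cauchy_Schwarz_energy[of f g] by (simp add: order.strict_trans1)
  then show ?thesis
    by (intro integrableI_bounded) (auto simp: power_less_top_ennreal)
qed

lemma integrable_bounded_mult:
  fixes f g :: "'a \<Rightarrow> complex"
  assumes "integrable M f" "g \<in> borel_measurable M" "\<And>x. cmod (g x) \<le> B"
  shows "integrable M (\<lambda>x. g x * f x)" "integrable M (\<lambda>x. f x * g x)"
proof -
  have "cmod (g x * f x) \<le> cmod (of_real B * f x)" for x
  proof -
    have "B \<ge> 0" using order_trans[OF norm_ge_zero assms(3)] .
    then show ?thesis using assms(3)[of x] by (simp add: norm_mult mult_right_mono)
  qed
  then have bound: "AE x in M. cmod (g x * f x) \<le> cmod (of_real B * f x)" by blast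
  have int: "integrable M (\<lambda>x. of_real B * f x)" using assms(1) by (rule integrable_mult_right)
  have meas: "(\<lambda>x. g x * f x) \<in> borel_measurable M"
    by (rule borel_measurable_times[OF assms(2) borel_measurable_integrable[OF assms(1)]])
  show *: "integrable M (\<lambda>x. g x * f x)"
    by (rule Bochner_Integration.integrable_bound[OF int meas bound])
  have "(\<lambda>x. f x * g x) = (\<lambda>x. g x * f x)" by (rule ext, rule mult.commute)
  with * show "integrable M (\<lambda>x. f x * g x)" by (simp only:)
qed

section \<open>The Fourier transform on \<open>L1\<close> and the multiplication formula\<close>

lemma borel_measurable_fourier_L1 [measurable (raw)]:
  assumes "f \<in> borel_measurable borel"
  shows "fourier_L1 f \<in> borel_measurable borel"
proof -
  have "(\<lambda>\<xi>. \<integral>x. f x * wave \<xi> (- x) \<partial>lborel) \<in> borel_measurable borel"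
    using assms by measurable
  then show ?thesis by (simp add: fourier_L1_wave[abs_def])
qed

lemma cmod_fourier_L1_le: "cmod (fourier_L1 f \<xi>) \<le> (\<integral>x. cmod (f x) \<partial>lborel)"
proof -
  have "cmod (fourier_L1 f \<xi>) \<le> (\<integral>x. cmod (f x * wave \<xi> (- x)) \<partial>lborel)"
    unfolding fourier_L1_wave by (rule integral_norm_bound)
  then show ?thesis by (simp add: norm_mult)
qed

lemma integrable_mult_wave:
  fixes f :: "'a::euclidean_space \<Rightarrow> complex"
  assumes "integrable lborel f"
  shows "integrable lborel (\<lambda>x. f x * wave \<xi> (- x))"
  using assms by (intro integrable_bounded_mult(2)[where B = 1]) auto

lemma integrable_prod_mult:
  fixes f :: "'a::euclidean_space \<Rightarrow> complex" and g :: "'b::euclidean_space \<Rightarrow> complex"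
  assumes "integrable lborel f" "integrable lborel g"
  shows "integrable (lborel \<Otimes>\<^sub>M lborel) (\<lambda>p. f (fst p) * g (snd p))"
proof -
  have [measurable]: "f \<in> borel_measurable borel" "g \<in> borel_measurable borel" using assms by auto
  have "(\<integral>\<^sup>+p. norm (f (fst p) * g (snd p)) \<partial>(lborel \<Otimes>\<^sub>M lborel))
     = (\<integral>\<^sup>+x. \<integral>\<^sup>+y. ennreal (norm (f x)) * ennreal (norm (g y)) \<partial>lborel \<partial>lborel)"
    by (subst lborel.nn_integral_fst[symmetric]) (auto simp: norm_mult ennreal_mult)
  also have "\<dots> = (\<integral>\<^sup>+x. norm (f x) \<partial>lborel) * (\<integral>\<^sup>+x. norm (g x) \<partial>lborel)"
    by (simp add: nn_integral_cmult nn_integral_multc)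
  also have "\<dots> < \<infinity>" using assms by (auto simp: integrable_iff_bounded ennreal_mult_less_top)
  finally show ?thesis by (intro integrableI_bounded) auto
qed

text \<open>The kernel \<open>wave \<xi> (- x)\<close> is symmetric in \<open>\<xi>\<close> and
  \<open>x\<close> and has modulus 1, so for two integrable factors Fubini moves the transform from
  one to the other.\<close>

lemma integral_fourier_L1_mult:
  assumes "g \<in> L1" "h \<in> L1"
  shows "(\<integral>\<xi>. fourier_L1 g \<xi> * h \<xi> \<partial>lborel) = (\<integral>x. g x * fourier_L1 h x \<partial>lborel)"
proof -
  have gh: "integrable lborel g" "integrable lborel h" using assms by (auto simp: L1_def)
  have [measurable]: "g \<in> borel_measurable borel" "h \<in> borel_measurable borel" using gh by auto
  have int: "integrable (lborel \<Otimes>\<^sub>M lborel) (\<lambda>(x, \<xi>). wave \<xi> (- x) * (g x * h \<xi>))"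
    using integrable_bounded_mult(1)[OF integrable_prod_mult[OF gh], of "\<lambda>(x, \<xi>). wave \<xi> (- x)" 1]
    by (simp add: case_prod_unfold)
  have "(\<integral>\<xi>. fourier_L1 g \<xi> * h \<xi> \<partial>lborel) = (\<integral>\<xi>. (\<integral>x. wave \<xi> (- x) * (g x * h \<xi>) \<partial>lborel) \<partial>lborel)"
    unfolding fourier_L1_wave integral_mult_left_zero[symmetric]
    by (simp only: mult_ac)
  also have "\<dots> = (\<integral>x. (\<integral>\<xi>. wave \<xi> (- x) * (g x * h \<xi>) \<partial>lborel) \<partial>lborel)"
    by (rule lborel_pair.Fubini_integral[OF int])
  also have "\<dots> = (\<integral>x. g x * fourier_L1 h x \<partial>lborel)"
  proof (intro Bochner_Integration.integral_cong refl)
    fix x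
    have "wave \<xi> (- x) * (g x * h \<xi>) = g x * (h \<xi> * wave x (- \<xi>))" for \<xi>
      by (simp add: wave_def inner_commute mult_ac)
    then show "(\<integral>\<xi>. wave \<xi> (- x) * (g x * h \<xi>) \<partial>lborel) = g x * fourier_L1 h x"
      by (simp only: fourier_L1_wave integral_mult_right_zero)
  qed
  finally show ?thesis .
qed

section \<open>Gaussian regularisation and Plancherel's inequality\<close>

text \<open>The Fourier transform of \<open>gaussian a\<close>: for \<open>a > 0\<close> a
  probability density, concentrating at the origin as \<open>a\<close> tends to 0. Damping by
  \<open>gaussian a\<close> on the Fourier side amounts to averaging against \<open>heat a\<close>
  in space.\<close>

definition heat :: "real \<Rightarrow> 'a::euclidean_space \<Rightarrow> real" where
  "heat a x = (1 / sqrt a) ^ DIM('a) * gaussian (1 / a) x"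

lemma heat_nonneg: "a > 0 \<Longrightarrow> 0 \<le> heat a x"
  by (simp add: heat_def)

lemma heat_commute: "heat a (x - y) = heat a (y - x)"
  by (simp add: heat_def gaussian_commute)

lemma borel_measurable_heat [measurable]:
  "heat a \<in> borel_measurable (borel :: 'a::euclidean_space measure)"
  unfolding heat_def[abs_def] by measurable

lemma integrable_heat: "a > 0 \<Longrightarrow> integrable lborel (heat a :: 'a::euclidean_space \<Rightarrow> real)"
  unfolding heat_def[abs_def] by (intro integrable_mult_right integrable_gaussian) auto

lemma integral_heat:
  assumes a: "a > 0"
  shows "(\<integral>x. heat a x \<partial>(lborel :: 'a::euclidean_space measure)) = 1"
proof -
  have "complex_of_real (\<integral>x. gaussian (1 / a) x \<partial>(lborel :: 'a measure))
     = (\<integral>x. complex_of_real (gaussian (1 / a) x) * wave 0 (- x) \<partial>(lborel :: 'a measure))"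
    by (simp add: wave_def)
  also have "\<dots> = complex_of_real ((1 / sqrt (1 / a)) ^ DIM('a))"
    using a by (subst gaussian_fourier(2)) (auto simp: gaussian_def)
  finally have "(\<integral>x. gaussian (1 / a) x \<partial>(lborel :: 'a measure)) = (1 / sqrt (1 / a)) ^ DIM('a)"
    by (simp only: of_real_eq_iff)
  then show ?thesis
    using a by (simp add: heat_def real_sqrt_divide power_divide)
qed

lemma nn_integral_heat:
  assumes "a > 0"
  shows "(\<integral>\<^sup>+y. heat a (y - x) \<partial>lborel) = 1" "(\<integral>\<^sup>+y. heat a (x - y) \<partial>lborel) = 1"
proof -
  have *: "(\<integral>\<^sup>+y. heat a y \<partial>(lborel :: 'a measure)) = 1"
    using assms by (subst nn_integral_eq_integral) (auto simp: integrable_heat heat_nonneg integral_heat)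
  then show "(\<integral>\<^sup>+y. heat a (y - x) \<partial>lborel) = 1"
    by (subst nn_integral_lborel_shift[where h = "\<lambda>z. ennreal (heat a z)"]) auto
  then show "(\<integral>\<^sup>+y. heat a (x - y) \<partial>lborel) = 1"
    by (simp add: heat_commute[of a x])
qed

lemma integrable_gaussian_wave:
  assumes "a > 0"
  shows "(\<lambda>\<xi>. complex_of_real (gaussian a \<xi>) * wave x \<xi>) \<in> L1"
  using gaussian_fourier(1)[OF assms, of "- x"] by (simp add: L1_def wave_minus)

lemma fourier_gaussian_wave:
  assumes a: "a > 0"
  shows "fourier_L1 (\<lambda>\<xi>. complex_of_real (gaussian a \<xi>) * wave x \<xi>) y = complex_of_real (heat a (y - x))"
proof -
  have "wave x \<xi> * wave y (- \<xi>) = wave (y - x) (- \<xi>)" for \<xi>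
    by (simp add: wave_def cis_mult inner_diff_left algebra_simps)
  then show ?thesis
    using gaussian_fourier(2)[OF a, of "y - x"]
    by (simp add: fourier_L1_wave mult.assoc heat_def)
qed

text \<open>Fourier inversion with a Gaussian damping factor: instead of the value of
  \<open>g\<close> at \<open>x\<close> it returns the heat average of \<open>g\<close> around
  \<open>x\<close>. Plancherel's inequality, injectivity on \<open>L1\<close> and the inversion for
  \<open>L2\<close> limits all rest on it.\<close>

lemma integral_fourier_gaussian_wave:
  assumes g: "g \<in> L1" and a: "a > 0"
  shows "(\<integral>\<xi>. fourier_L1 g \<xi> * (complex_of_real (gaussian a \<xi>) * wave x \<xi>) \<partial>lborel)
       = (\<integral>y. g y * complex_of_real (heat a (y - x)) \<partial>lborel)"
  by (simp add: integral_fourier_L1_mult[OF g integrable_gaussian_wave[OF a]] fourier_gaussian_wave[OF a])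

text \<open>The multiplication formula turns the damped energy of the transform into a double
  integral of \<open>g x\<close> and the conjugate of \<open>g y\<close> against the kernel
  \<open>heat a (y - x)\<close>. Bounding the product of moduli by half the sum of squares leaves
  two terms, each equal to half of \<open>energy g\<close>, since the kernel has mass 1 in either
  variable.\<close>

lemma energy_fourier_gaussian_le:
  assumes g: "g \<in> L1" and a: "a > 0"
  shows "(\<integral>\<^sup>+\<xi>. ennreal ((cmod (fourier_L1 g \<xi>))\<^sup>2 * gaussian a \<xi>) \<partial>lborel) \<le> energy g"
proof -
  have [measurable]: "g \<in> borel_measurable borel" using g by auto
  define B where "B = (\<integral>x. cmod (g x) \<partial>lborel)"
  \<comment> \<open>Chosen so that \<open>fourier_L1 g \<xi> * h \<xi>\<close> is the damped squared
    modulus, while the transform of \<open>h\<close> is the conjugate of a heat average of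
    \<open>g\<close>.\<close>
  define h where "h \<xi> = cnj (fourier_L1 g \<xi>) * complex_of_real (gaussian a \<xi>)" for \<xi>
  have gau: "integrable lborel (\<lambda>\<xi>::real^'a. complex_of_real (gaussian a \<xi>))"
    using a by (simp add: integrable_gaussian)
  have bound: "cmod (fourier_L1 g \<xi>) \<le> B" for \<xi>
    unfolding B_def by (rule cmod_fourier_L1_le)
  have "integrable lborel h" unfolding h_def
    by (rule integrable_bounded_mult(1)[where B = B, OF gau]) (auto simp: bound)
  then have h: "h \<in> L1" by (simp add: L1_def)
  have eq: "fourier_L1 g \<xi> * h \<xi> = complex_of_real ((cmod (fourier_L1 g \<xi>))\<^sup>2 * gaussian a \<xi>)" for \<xi>
    by (simp only: h_def of_real_mult complex_norm_square mult.assoc)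
  have int: "integrable lborel (\<lambda>\<xi>. fourier_L1 g \<xi> * h \<xi>)"
    using \<open>integrable lborel h\<close> by (rule integrable_bounded_mult(1)[where B = B]) (auto simp: bound)
  have intr: "integrable lborel (\<lambda>\<xi>. (cmod (fourier_L1 g \<xi>))\<^sup>2 * gaussian a \<xi>)"
    using int unfolding eq complex_of_real_integrable_eq .
  have hhat: "fourier_L1 h x = cnj (\<integral>y. g y * complex_of_real (heat a (y - x)) \<partial>lborel)" for x
  proof -
    have "cnj (\<integral>\<xi>. fourier_L1 g \<xi> * (complex_of_real (gaussian a \<xi>) * wave x \<xi>) \<partial>lborel) = fourier_L1 h x"
      unfolding Bochner_Integration.integral_cnj[symmetric] fourier_L1_wave[of h] 
      by (simp only: h_def cnj_wave mult.assoc complex_cnj_mult complex_cnj_complex_of_real)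
    then show ?thesis by (simp only: integral_fourier_gaussian_wave[OF g a])
  qed
  have sq: "ennreal (cmod s * cmod t) \<le> ennreal (1 / 2) * (ennreal ((cmod s)\<^sup>2) + ennreal ((cmod t)\<^sup>2))" for s t
  proof -
    have "cmod s * cmod t \<le> (1 / 2) * ((cmod s)\<^sup>2 + (cmod t)\<^sup>2)"
      using sum_squares_bound[of "cmod s" "cmod t"] by simp
    then have "ennreal (cmod s * cmod t) \<le> ennreal ((1 / 2) * ((cmod s)\<^sup>2 + (cmod t)\<^sup>2))"
      by (rule ennreal_leI)
    then show ?thesis
      by (subst (asm) ennreal_mult) (auto simp: ennreal_plus)
  qed
  have "(\<integral>\<^sup>+\<xi>. ennreal ((cmod (fourier_L1 g \<xi>))\<^sup>2 * gaussian a \<xi>) \<partial>lborel)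
      = ennreal (\<integral>\<xi>. (cmod (fourier_L1 g \<xi>))\<^sup>2 * gaussian a \<xi> \<partial>lborel)"
    using intr by (rule nn_integral_eq_integral) simp
  also have "\<dots> = ennreal (cmod (\<integral>\<xi>. fourier_L1 g \<xi> * h \<xi> \<partial>lborel))"
    unfolding eq integral_complex_of_real norm_of_real by simp
  also have "\<dots> = ennreal (cmod (\<integral>x. g x * fourier_L1 h x \<partial>lborel))"
    by (simp add: integral_fourier_L1_mult[OF g h])
  also have "\<dots> \<le> (\<integral>\<^sup>+x. cmod (g x * fourier_L1 h x) \<partial>lborel)"
    by (rule ennreal_norm_integral_le)
  also have "\<dots> \<le> (\<integral>\<^sup>+x. (\<integral>\<^sup>+y. ennreal (1 / 2) * (ennreal ((cmod (g x))\<^sup>2) + ennreal ((cmod (g y))\<^sup>2)) * heat a (y - x) \<partial>lborel) \<partial>lborel)"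
  proof (rule nn_integral_mono)
    fix x
    have "ennreal (cmod (g x * fourier_L1 h x)) = ennreal (cmod (g x)) * ennreal (cmod (\<integral>y. g y * complex_of_real (heat a (y - x)) \<partial>lborel))"
      by (simp add: norm_mult hhat ennreal_mult)
    also have "\<dots> \<le> ennreal (cmod (g x)) * (\<integral>\<^sup>+y. cmod (g y * complex_of_real (heat a (y - x))) \<partial>lborel)"
      by (intro mult_left_mono ennreal_norm_integral_le) auto
    also have "\<dots> = (\<integral>\<^sup>+y. ennreal (cmod (g x) * cmod (g y)) * heat a (y - x) \<partial>lborel)"
      using a by (subst nn_integral_cmult[symmetric]) (auto simp: norm_mult ennreal_mult heat_nonneg mult_ac)
    also have "\<dots> \<le> (\<integral>\<^sup>+y. ennreal (1 / 2) * (ennreal ((cmod (g x))\<^sup>2) + ennreal ((cmod (g y))\<^sup>2)) * heat a (y - x) \<partial>lborel)"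
      by (intro nn_integral_mono mult_right_mono sq) auto
    finally show "ennreal (cmod (g x * fourier_L1 h x)) \<le> (\<integral>\<^sup>+y. ennreal (1 / 2) * (ennreal ((cmod (g x))\<^sup>2) + ennreal ((cmod (g y))\<^sup>2)) * heat a (y - x) \<partial>lborel)" .
  qed
  also have "\<dots> = ennreal (1 / 2) * ((\<integral>\<^sup>+x. (\<integral>\<^sup>+y. ennreal ((cmod (g x))\<^sup>2) * heat a (y - x) \<partial>lborel) \<partial>lborel)
      + (\<integral>\<^sup>+x. (\<integral>\<^sup>+y. ennreal ((cmod (g y))\<^sup>2) * heat a (y - x) \<partial>lborel) \<partial>lborel))"
    by (simp add: mult.assoc nn_integral_cmult distrib_right nn_integral_add)
  also have "(\<integral>\<^sup>+x. (\<integral>\<^sup>+y. ennreal ((cmod (g x))\<^sup>2) * heat a (y - x) \<partial>lborel) \<partial>lborel) = energy g"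
    using a by (simp add: nn_integral_cmult nn_integral_heat energy_def)
  \<comment> \<open>Here \<open>g\<close> depends on the inner variable; exchanging the order lets
    the kernel be integrated first.\<close>
  also have "(\<integral>\<^sup>+x. (\<integral>\<^sup>+y. ennreal ((cmod (g y))\<^sup>2) * heat a (y - x) \<partial>lborel) \<partial>lborel)
     = (\<integral>\<^sup>+y. (\<integral>\<^sup>+x. ennreal ((cmod (g y))\<^sup>2) * heat a (y - x) \<partial>lborel) \<partial>lborel)"
    by (rule lborel_pair.Fubini') measurable
  also have "\<dots> = energy g"
    using a by (simp add: nn_integral_cmult nn_integral_heat energy_def)
  also have "ennreal (1 / 2) * (energy g + energy g) = energy g"
  proof -
    have "ennreal (1 / 2) * (energy g + energy g) = (ennreal (1 / 2) * 2) * energy g"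
      by (simp add: mult_2[symmetric] mult.assoc)
    also have "ennreal (1 / 2) * 2 = 1"
      using ennreal_mult[of "1 / 2" 2] by simp
    finally show ?thesis by simp
  qed
  finally show ?thesis .
qed

text \<open>The damping factor with parameter \<open>1 / real (Suc n)\<close> tends to 1 pointwise
  while the damped energies stay below \<open>energy g\<close>, so Fatou's lemma removes it.\<close>

lemma energy_fourier_L1_le:
  assumes g: "g \<in> L1"
  shows "energy (fourier_L1 g) \<le> energy g"
proof -
  have [measurable]: "g \<in> borel_measurable borel" using g by auto
  have lim: "(\<lambda>n. gaussian (1 / real (Suc n)) \<xi>) \<longlonglongrightarrow> 1" for \<xi> :: "real^'a"
  proof -
    have "(\<lambda>n. exp (- (pi * (1 / real (Suc n)) * (norm \<xi>)\<^sup>2))) \<longlonglongrightarrow> exp (- (pi * 0 * (norm \<xi>)\<^sup>2))"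
      by (intro tendsto_intros LIMSEQ_Suc lim_1_over_n)
    then show ?thesis by (simp add: gaussian_def)
  qed
  have "energy (fourier_L1 g) = (\<integral>\<^sup>+\<xi>. liminf (\<lambda>n. ennreal ((cmod (fourier_L1 g \<xi>))\<^sup>2 * gaussian (1 / real (Suc n)) \<xi>)) \<partial>lborel)"
    unfolding energy_def
  proof (intro nn_integral_cong)
    fix \<xi>
    have "(\<lambda>n. ennreal ((cmod (fourier_L1 g \<xi>))\<^sup>2 * gaussian (1 / real (Suc n)) \<xi>)) \<longlonglongrightarrow> ennreal ((cmod (fourier_L1 g \<xi>))\<^sup>2 * 1)"
      by (intro tendsto_intros lim)
    from lim_imp_Liminf[OF _ this]
    show "ennreal ((cmod (fourier_L1 g \<xi>))\<^sup>2) = liminf (\<lambda>n. ennreal ((cmod (fourier_L1 g \<xi>))\<^sup>2 * gaussian (1 / real (Suc n)) \<xi>))"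
      by (simp del: of_nat_Suc)
  qed
  also have "\<dots> \<le> liminf (\<lambda>n. \<integral>\<^sup>+\<xi>. ennreal ((cmod (fourier_L1 g \<xi>))\<^sup>2 * gaussian (1 / real (Suc n)) \<xi>) \<partial>lborel)"
    by (rule nn_integral_liminf) measurable
  also have "\<dots> \<le> energy g"
    by (rule Liminf_le) (auto intro!: always_eventually energy_fourier_gaussian_le g simp del: of_nat_Suc)
  finally show ?thesis .
qed

section \<open>Injectivity of the Fourier transform on \<open>L1\<close>\<close>

text \<open>Substituting \<open>x = y + c n *\<^sub>R z\<close>, with \<open>c n\<close> the square
  root of the parameter, replaces the shrinking kernel by the fixed density \<open>heat 1\<close>;
  dominated convergence and continuity at \<open>y\<close> finish.\<close>

lemma heat_convolution_tendsto:
  fixes \<phi> :: "'a::euclidean_space \<Rightarrow> real"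
  assumes cont: "continuous_on UNIV \<phi>" and bound: "\<And>x. \<bar>\<phi> x\<bar> \<le> B"
  shows "(\<lambda>n. \<integral>x. \<phi> x * heat (1 / real (Suc n)) (y - x) \<partial>lborel) \<longlonglongrightarrow> \<phi> y"
proof -
  have [measurable]: "\<phi> \<in> borel_measurable borel" by (rule borel_measurable_continuous_onI[OF cont])
  define c where "c n = sqrt (1 / real (Suc n))" for n
  have c: "c n > 0" for n by (simp add: c_def del: of_nat_Suc)
  have scale: "c n ^ DIM('a) * heat (1 / real (Suc n)) (c n *\<^sub>R z) = heat 1 z" for n and z :: 'a
  proof -
    have "gaussian (real (Suc n)) (c n *\<^sub>R z) = gaussian 1 z"
      unfolding gaussian_def by (simp add: c_def power_mult_distrib power_divide del: of_nat_Suc)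
    moreover have "c n ^ DIM('a) * (1 / c n) ^ DIM('a) = 1"
      using c[of n] by (simp add: power_divide)
    ultimately show ?thesis
      by (simp add: heat_def c_def[symmetric] mult.assoc[symmetric] del: of_nat_Suc)
  qed
  have subst: "(\<integral>x. \<phi> x * heat (1 / real (Suc n)) (y - x) \<partial>lborel) = (\<integral>z. \<phi> (y + c n *\<^sub>R z) * heat 1 z \<partial>lborel)" for n
  proof -
    have "(\<integral>x. \<phi> x * heat (1 / real (Suc n)) (y - x) \<partial>lborel)
      = (c n ^ DIM('a)) *\<^sub>R (\<integral>z. \<phi> (y + c n *\<^sub>R z) * heat (1 / real (Suc n)) (y - (y + c n *\<^sub>R z)) \<partial>lborel)"
      using c[of n] by (subst integral_lborel_affine[of _ "c n" y]) auto
    also have "\<dots> = (\<integral>z. \<phi> (y + c n *\<^sub>R z) * (c n ^ DIM('a) * heat (1 / real (Suc n)) (c n *\<^sub>R z)) \<partial>lborel)"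
      unfolding integral_scaleR_right[symmetric] heat_def
      by (intro Bochner_Integration.integral_cong refl) (simp del: of_nat_Suc)
    finally show ?thesis by (simp only: scale)
  qed
  have "(\<lambda>n. \<integral>z. \<phi> (y + c n *\<^sub>R z) * heat 1 z \<partial>lborel) \<longlonglongrightarrow> (\<integral>(z::'a). \<phi> y * heat 1 z \<partial>lborel)"
  proof (rule integral_dominated_convergence[where w = "\<lambda>z::'a. B * heat 1 z"])
    show "integrable lborel (\<lambda>z::'a. B * heat 1 z)" by (intro integrable_mult_right integrable_heat) simp
    show "AE z in lborel. (\<lambda>n. \<phi> (y + c n *\<^sub>R z) * heat 1 z) \<longlonglongrightarrow> \<phi> y * heat 1 z"
    proof (intro AE_I2 tendsto_intros)
      fix z
      have "c \<longlonglongrightarrow> sqrt 0" unfolding c_def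
        by (intro tendsto_intros LIMSEQ_Suc lim_1_over_n)
      then have "(\<lambda>n. y + c n *\<^sub>R z) \<longlonglongrightarrow> y + 0 *\<^sub>R z" by (intro tendsto_intros) simp
      then show "(\<lambda>n. \<phi> (y + c n *\<^sub>R z)) \<longlonglongrightarrow> \<phi> y"
        using cont by (intro isCont_tendsto_compose[where g = \<phi>]) (auto simp: continuous_on_eq_continuous_at)
    qed
    show "AE z in lborel. norm (\<phi> (y + c n *\<^sub>R z) * heat 1 z) \<le> B * heat 1 z" for n
      using bound by (intro AE_I2) (simp add: abs_mult heat_nonneg mult_right_mono)
  qed measurable
  then show ?thesis by (simp only: subst integral_mult_right_zero integral_heat[OF zero_less_one] mult_1_right)
qed

text \<open>The class of test functions annihilated by \<open>k\<close> is enlarged step by step: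
  heat kernels, bounded continuous functions, indicators of open sets, indicators of Borel
  sets.\<close>

lemma integral_heat_zero_imp_AE_zero:
  fixes k :: "'a::euclidean_space \<Rightarrow> complex"
  assumes k: "integrable lborel k"
    and zero: "\<And>a x. a > 0 \<Longrightarrow> (\<integral>y. k y * complex_of_real (heat a (y - x)) \<partial>lborel) = 0"
  shows "AE x in lborel. k x = 0"
proof -
  have [measurable]: "k \<in> borel_measurable borel" using k by auto
  have cont_test: "(\<integral>y. k y * complex_of_real (\<phi> y) \<partial>lborel) = 0"
    if cont: "continuous_on UNIV \<phi>" and bound: "\<And>x. \<bar>\<phi> x\<bar> \<le> B" for \<phi> :: "'a \<Rightarrow> real" and B
  proof -
    have [measurable]: "\<phi> \<in> borel_measurable borel" by (rule borel_measurable_continuous_onI[OF cont])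
    have B: "B \<ge> 0" using bound[of 0] by linarith
    \<comment> \<open>The smoothed test function is a superposition of heat kernels, so Fubini shows
      that \<open>k\<close> annihilates it; as \<open>n\<close> grows it tends boundedly to
      \<open>\<phi>\<close>.\<close>
    define \<Phi> where "\<Phi> n y = (\<integral>x. \<phi> x * heat (1 / real (Suc n)) (y - x) \<partial>lborel)" for n y
    have [measurable]: "\<Phi> n \<in> borel_measurable borel" for n
      unfolding \<Phi>_def by measurable
    have \<Phi>_bound: "\<bar>\<Phi> n y\<bar> \<le> B" for n y
    proof -
      have "ennreal \<bar>\<Phi> n y\<bar> \<le> (\<integral>\<^sup>+x. norm (\<phi> x * heat (1 / real (Suc n)) (y - x)) \<partial>lborel)"
        using ennreal_norm_integral_le[of lborel "\<lambda>x. \<phi> x * heat (1 / real (Suc n)) (y - x)"] by (simp add: \<Phi>_def)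
      also have "\<dots> \<le> (\<integral>\<^sup>+x. ennreal B * heat (1 / real (Suc n)) (y - x) \<partial>lborel)"
        using bound B by (intro nn_integral_mono) (auto simp: abs_mult heat_nonneg ennreal_mult'[symmetric] mult_right_mono simp del: of_nat_Suc intro!: ennreal_leI)
      also have "\<dots> = ennreal B"
        by (subst nn_integral_cmult) (auto simp: nn_integral_heat simp del: of_nat_Suc)
      finally show ?thesis using B by (simp add: ennreal_le_iff)
    qed
    have "(\<integral>y. k y * complex_of_real (\<Phi> n y) \<partial>lborel) = 0" for n
    proof -
      let ?a = "1 / real (Suc n)"
      let ?F = "\<lambda>y x. k y * complex_of_real (\<phi> x * heat ?a (y - x))"
      have int: "integrable (lborel \<Otimes>\<^sub>M lborel) (case_prod ?F)"
      proof (rule integrableI_bounded)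
        have "(\<integral>\<^sup>+p. norm (case_prod ?F p) \<partial>(lborel \<Otimes>\<^sub>M lborel)) = (\<integral>\<^sup>+y. (\<integral>\<^sup>+x. norm (?F y x) \<partial>lborel) \<partial>lborel)"
          by (subst lborel.nn_integral_fst[symmetric]) (auto simp: case_prod_unfold)
        also have "\<dots> \<le> (\<integral>\<^sup>+y. (\<integral>\<^sup>+x. ennreal (cmod (k y) * B) * heat ?a (y - x) \<partial>lborel) \<partial>lborel)"
          using bound B by (intro nn_integral_mono)
            (auto simp: norm_mult abs_mult heat_nonneg ennreal_mult'[symmetric] mult.assoc
               simp del: of_nat_Suc intro!: ennreal_leI mult_left_mono mult_right_mono)
        also have "\<dots> = (\<integral>\<^sup>+y. ennreal (cmod (k y) * B) \<partial>lborel)"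
          by (intro nn_integral_cong, subst nn_integral_cmult) (auto simp: nn_integral_heat simp del: of_nat_Suc)
        also have "\<dots> < \<infinity>"
          using k B by (simp add: ennreal_mult nn_integral_multc integrable_iff_bounded ennreal_mult_less_top)
        finally show "(\<integral>\<^sup>+p. norm (case_prod ?F p) \<partial>(lborel \<Otimes>\<^sub>M lborel)) < \<infinity>" .
      qed (simp add: case_prod_unfold)
      have "(\<integral>y. k y * complex_of_real (\<Phi> n y) \<partial>lborel) = (\<integral>y. (\<integral>x. ?F y x \<partial>lborel) \<partial>lborel)"
        by (simp only: \<Phi>_def integral_complex_of_real[symmetric] integral_mult_right_zero)
      also have "\<dots> = (\<integral>x. (\<integral>y. ?F y x \<partial>lborel) \<partial>lborel)"
        by (rule lborel_pair.Fubini_integral[symmetric, OF int])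
      also have "\<dots> = (\<integral>x. complex_of_real (\<phi> x) * (\<integral>y. k y * complex_of_real (heat ?a (y - x)) \<partial>lborel) \<partial>lborel)"
        unfolding integral_mult_right_zero[symmetric]
        by (intro Bochner_Integration.integral_cong refl) (simp add: mult_ac del: of_nat_Suc)
      also have "\<dots> = 0"
        using zero[of ?a] by (simp del: of_nat_Suc)
      finally show ?thesis .
    qed
    moreover have "(\<lambda>n. \<integral>y. k y * complex_of_real (\<Phi> n y) \<partial>lborel) \<longlonglongrightarrow> (\<integral>y. k y * complex_of_real (\<phi> y) \<partial>lborel)"
    proof (rule integral_dominated_convergence[where w = "\<lambda>y. cmod (k y) * B"])
      show "integrable lborel (\<lambda>y. cmod (k y) * B)" using k by (intro integrable_mult_left integrable_norm)
      show "AE y in lborel. (\<lambda>n. k y * complex_of_real (\<Phi> n y)) \<longlonglongrightarrow> k y * complex_of_real (\<phi> y)"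
        unfolding \<Phi>_def by (intro AE_I2 tendsto_mult tendsto_const tendsto_of_real heat_convolution_tendsto[OF cont bound])
      show "AE y in lborel. norm (k y * complex_of_real (\<Phi> n y)) \<le> cmod (k y) * B" for n
        using \<Phi>_bound by (intro AE_I2) (simp add: norm_mult mult_left_mono)
    qed measurable
    ultimately show ?thesis by (simp add: LIMSEQ_const_iff)
  qed
  have k_ind: "integrable lborel (\<lambda>y. k y * indicator A y)" if "A \<in> sets borel" for A
    using k that by (intro integrable_bounded_mult(2)[where B = 1]) (auto simp: indicator_def)
  have "(\<integral>y. k y * complex_of_real 1 \<partial>lborel) = 0"
    by (rule cont_test[where B = 1]) auto
  then have k_int: "(\<integral>y. k y \<partial>lborel) = 0" by simp
  have open_test: "(\<integral>y. k y * indicator U y \<partial>lborel) = 0" if U: "open U" for U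
  \<comment> \<open>The whole space is separated because \<open>infdist\<close> to the empty set is
    0 by convention, so the truncated distances to the complement would not approximate its
    indicator.\<close>
  proof (cases "U = UNIV")
    case True
    then show ?thesis using k_int by simp
  next
    case False
    have [measurable]: "U \<in> sets borel" using U by simp
    define \<phi> where "\<phi> n y = min 1 (real n * infdist y (- U))" for n y
    have \<phi>01: "0 \<le> \<phi> n y" "\<phi> n y \<le> 1" for n y by (auto simp: \<phi>_def infdist_nonneg)
    have \<phi>c: "continuous_on UNIV (\<phi> n)" for n
      unfolding \<phi>_def by (intro continuous_intros)
    have [measurable]: "\<phi> n \<in> borel_measurable borel" for n by (rule borel_measurable_continuous_onI[OF \<phi>c])
    have lim: "(\<lambda>n. \<phi> n y) \<longlonglongrightarrow> indicator U y" for y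
    proof (cases "y \<in> U")
      case True
      then have pos: "infdist y (- U) > 0"
        using False U by (intro infdist_pos_not_in_closed) auto
      have "eventually (\<lambda>n. \<phi> n y = 1) sequentially"
      proof -
        obtain N where N: "real N * infdist y (- U) > 1" using reals_Archimedean3[OF pos] by blast
        have "\<phi> n y = 1" if "n \<ge> N" for n
        proof -
          have "real N * infdist y (- U) \<le> real n * infdist y (- U)" using that pos by (intro mult_right_mono) auto
          then show ?thesis using N by (simp add: \<phi>_def)
        qed
        then show ?thesis by (auto simp: eventually_sequentially)
      qed
      then show ?thesis using True by (simp add: tendsto_eventually)
    next
      case False
      then show ?thesis by (simp add: \<phi>_def)
    qed
    have "(\<lambda>n. \<integral>y. k y * complex_of_real (\<phi> n y) \<partial>lborel) \<longlonglongrightarrow> (\<integral>y. k y * complex_of_real (indicator U y) \<partial>lborel)"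
    proof (rule integral_dominated_convergence[where w = "\<lambda>y. cmod (k y)"])
      show "integrable lborel (\<lambda>y. cmod (k y))" using k by (rule integrable_norm)
      show "AE y in lborel. (\<lambda>n. k y * complex_of_real (\<phi> n y)) \<longlonglongrightarrow> k y * complex_of_real (indicator U y)"
        by (intro AE_I2 tendsto_mult tendsto_const tendsto_of_real lim)
      show "AE y in lborel. norm (k y * complex_of_real (\<phi> n y)) \<le> cmod (k y)" for n
        using \<phi>01 by (intro AE_I2) (simp add: norm_mult mult_left_le)
    qed measurable
    moreover have "(\<integral>y. k y * complex_of_real (\<phi> n y) \<partial>lborel) = 0" for n
      using \<phi>01 by (intro cont_test[where B = 1] \<phi>c) auto
    moreover have "complex_of_real (indicator U y) = indicator U y" for y by (simp add: indicator_def)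
    ultimately show ?thesis by (simp add: LIMSEQ_const_iff)
  qed
  \<comment> \<open>A Dynkin system argument: open sets are stable under intersection, and
    complements are handled by \<open>k_int\<close>, which comes from the constant test function
    1.\<close>
  have borel_test: "(\<integral>y. k y * indicator A y \<partial>lborel) = 0" if A: "A \<in> sets borel" for A
  proof -
    have "Int_stable {S. open (S :: 'a set)}" by (auto simp: Int_stable_def)
    moreover have "{S. open S} \<subseteq> Pow (UNIV :: 'a set)" by simp
    moreover have "A \<in> sigma_sets UNIV {S. open S}" using A by (simp add: borel_def)
    ultimately show ?thesis
    proof (induction rule: sigma_sets_induct_disjoint)
      case (basic A)
      then show ?case by (simp add: open_test)
    next
      case empty
      then show ?case by simp
    next
      case (compl A)
      then have A: "A \<in> sets borel" by (simp add: borel_def)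
      have "k y * indicator (UNIV - A) y = k y - k y * indicator A y" for y by (simp add: indicator_def)
      then show ?case using compl k_int by (simp add: k k_ind[OF A])
    next
      case (union A)
      then have A: "A i \<in> sets borel" for i by (auto simp: borel_def)
      have *: "set_lebesgue_integral lborel X k = (\<integral>y. k y * indicator X y \<partial>lborel)" for X
        unfolding set_lebesgue_integral_def
        by (intro Bochner_Integration.integral_cong refl) (simp add: indicator_def)
      have "set_lebesgue_integral lborel (\<Union>i. A i) k = (\<Sum>i. set_lebesgue_integral lborel (A i) k)"
      proof (rule lebesgue_integral_countable_add)
        show "A i \<in> sets lborel" for i using A by simp
        show "A i \<inter> A j = {}" if "i \<noteq> j" for i j using union that by (auto simp: disjoint_family_on_def)
        show "set_integrable lborel (\<Union>i. A i) k"
          unfolding set_integrable_def using A k by (intro integrable_mult_indicator) auto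
      qed
      then show ?case using union by (simp add: *)
    qed
  qed
  show ?thesis
  proof (rule sigma_finite_measure.density_zero[OF sigma_finite_lborel k])
    fix A :: "'a set" assume "A \<in> sets lborel"
    then have "(\<integral>y. k y * indicator A y \<partial>lborel) = 0" using borel_test by simp
    moreover have "(\<integral>y. k y * indicator A y \<partial>lborel) = set_lebesgue_integral lborel A k"
      unfolding set_lebesgue_integral_def
      by (intro Bochner_Integration.integral_cong refl) (simp add: indicator_def)
    ultimately show "set_lebesgue_integral lborel A k = 0" by simp
  qed
qed

text \<open>By damped inversion, a vanishing transform forces every heat average of \<open>k\<close>
  to vanish.\<close>

lemma fourier_L1_zero_imp_AE_zero:
  assumes k: "k \<in> L1" and zero: "\<And>\<xi>. fourier_L1 k \<xi> = 0"
  shows "AE x in lborel. k x = 0"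
proof (rule integral_heat_zero_imp_AE_zero)
  show "integrable lborel k" using k by (simp add: L1_def)
  show "(\<integral>y. k y * complex_of_real (heat a (y - x)) \<partial>lborel) = 0" if "a > 0" for a x
    using integral_fourier_gaussian_wave[OF k that, of x] by (simp add: zero)
qed

section \<open>Band-limited functions\<close>

lemma borel_measurable_fourier_L1_comp [measurable (raw)]:
  assumes "f \<in> borel_measurable borel" "g \<in> borel_measurable M"
  shows "(\<lambda>x. fourier_L1 f (g x)) \<in> borel_measurable M"
  using measurable_compose[OF assms(2) borel_measurable_fourier_L1[OF assms(1)]] .

lemma L2_norm_energy: "L2_norm f = ennreal_sqrt (energy f)"
  by (simp add: L2_norm_def energy_def)

text \<open>The union that defines the complement of the support may be uncountable; the Lindelof
  property extracts a countable subfamily with the same union, for which the exceptional null sets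
  can be collected.\<close>

lemma ess_support_AE: "AE x in lborel. x \<notin> ess_support F \<longrightarrow> F x = 0"
proof -
  define \<V> where "\<V> = {V. open V \<and> (AE x in lborel. x \<in> V \<longrightarrow> F x = 0)}"
  obtain \<V>' where \<V>': "\<V>' \<subseteq> \<V>" "countable \<V>'" "\<Union>\<V>' = \<Union>\<V>"
    using Lindelof[of \<V>] by (auto simp: \<V>_def)
  have "AE x in lborel. \<forall>V\<in>\<V>'. x \<in> V \<longrightarrow> F x = 0"
    using \<V>'(1) by (subst AE_ball_countable[OF \<V>'(2)]) (auto simp: \<V>_def)
  then show ?thesis
  proof eventually_elim
    case (elim x)
    then show ?case using \<V>'(3) by (auto simp: ess_support_def \<V>_def)
  qed
qed

lemma energy_cong_AE: "AE x in lborel. f x = g x \<Longrightarrow> energy f = energy g"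
  unfolding energy_def by (rule nn_integral_cong_AE) auto

text \<open>Once a norm is below 1, its square is below the norm itself.\<close>

lemma L2_norm_tendsto_0_imp_energy:
  assumes "(\<lambda>n. L2_norm (u n)) \<longlonglongrightarrow> 0"
  shows "(\<lambda>n. energy (u n)) \<longlonglongrightarrow> 0"
proof (rule tendsto_sandwich[OF _ _ tendsto_const assms])
  have "eventually (\<lambda>n. L2_norm (u n) < 1) sequentially"
    using assms by (rule order_tendstoD) simp
  then show "eventually (\<lambda>n. energy (u n) \<le> L2_norm (u n)) sequentially"
  proof eventually_elim
    case (elim n)
    then show ?case
      using mult_left_mono[of "L2_norm (u n)" 1 "L2_norm (u n)"]
      by (simp add: L2_norm_power2[symmetric] power2_eq_square)
  qed
qed auto

text \<open>Strong convergence implies weak convergence, by Cauchy-Schwarz. The pairing is bilinear,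
  without conjugation, to match the multiplication formula.\<close>

lemma integral_mult_tendsto:
  assumes u: "\<And>n. u n \<in> L2" and v: "v \<in> L2" and h: "h \<in> L2"
    and lim: "(\<lambda>n. energy (\<lambda>x. u n x - v x)) \<longlonglongrightarrow> 0"
  shows "(\<lambda>n. \<integral>x. u n x * h x \<partial>lborel) \<longlonglongrightarrow> (\<integral>x. v x * h x \<partial>lborel)"
proof -
  have [measurable]: "u n \<in> borel_measurable borel" "v \<in> borel_measurable borel" "h \<in> borel_measurable borel" for n
    using u v h by auto
  define c where "c n = (cmod ((\<integral>x. u n x * h x \<partial>lborel) - (\<integral>x. v x * h x \<partial>lborel)))\<^sup>2" for n
  have le: "ennreal (c n) \<le> energy h * energy (\<lambda>x. u n x - v x)" for n
  proof -
    have "(\<integral>x. u n x * h x \<partial>lborel) - (\<integral>x. v x * h x \<partial>lborel) = (\<integral>x. (u n x - v x) * h x \<partial>lborel)"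
      using integrable_L2_mult[OF u h] integrable_L2_mult[OF v h] by (simp add: left_diff_distrib)
    then have "ennreal (c n) = (ennreal (cmod (\<integral>x. (u n x - v x) * h x \<partial>lborel)))\<^sup>2"
      by (simp add: c_def ennreal_power)
    also have "\<dots> \<le> (\<integral>\<^sup>+x. cmod ((u n x - v x) * h x) \<partial>lborel)\<^sup>2"
      by (intro power_mono ennreal_norm_integral_le) simp
    also have "\<dots> \<le> energy h * energy (\<lambda>x. u n x - v x)"
      by (subst mult.commute, rule nn_integral_Cauchy_Schwarz_energy) measurable
    finally show ?thesis .
  qed
  have "energy h < top" using h by (simp add: L2_iff_energy)
  from ennreal_tendsto_cmult[OF this lim]
  have "(\<lambda>n. energy h * energy (\<lambda>x. u n x - v x)) \<longlonglongrightarrow> 0" by simp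
  then have "(\<lambda>n. ennreal (c n)) \<longlonglongrightarrow> 0"
    by (rule tendsto_sandwich[rotated 3]) (auto simp: le)
  then have "c \<longlonglongrightarrow> 0"
    by (subst (asm) ennreal_tendsto_0_iff) (auto simp: c_def)
  then have "(\<lambda>n. sqrt (c n)) \<longlonglongrightarrow> sqrt 0" by (rule tendsto_real_sqrt)
  then have "(\<lambda>n. (\<integral>x. u n x * h x \<partial>lborel) - (\<integral>x. v x * h x \<partial>lborel)) \<longlonglongrightarrow> 0"
    by (subst tendsto_norm_zero_iff[symmetric]) (simp add: c_def)
  then show ?thesis by (rule LIM_zero_cancel)
qed

lemma energy_reflect:
  assumes "f \<in> borel_measurable borel"
  shows "energy (\<lambda>x. f (- x)) = energy f"
  using assms nn_integral_lborel_reflect[of "\<lambda>x. ennreal ((cmod (f x))\<^sup>2)" 0] by (simp add: energy_def)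

lemma gaussian_shift_L1_L2:
  "(\<lambda>x :: real ^ 'd::finite. complex_of_real (gaussian 1 (x - \<xi>))) \<in> L1 \<inter> L2"
proof -
  have int: "integrable lborel (\<lambda>x :: real ^ 'd. gaussian 1 (x - \<xi>))"
    using integrable_lborel_affine[OF integrable_gaussian[of 1], of 1 "- \<xi>"] by simp
  have "integrable lborel (\<lambda>x :: real ^ 'd. (gaussian 1 (x - \<xi>))\<^sup>2)"
    by (rule Bochner_Integration.integrable_bound[OF int])
      (auto simp: power2_eq_square mult_left_le gaussian_le_1)
  with int show ?thesis by (simp add: L1_def L2_def)
qed

text \<open>Since \<open>gaussian 1\<close> is self-dual, a shift by \<open>\<xi>\<close> becomes a
  character. Pairing with these functions therefore evaluates, at \<open>\<xi>\<close>, the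
  transform of a signal weighted by a Gaussian.\<close>

lemma fourier_gaussian_shift:
  fixes \<xi> x :: "real ^ 'd::finite"
  shows "fourier_L1 (\<lambda>\<omega>. complex_of_real (gaussian 1 (\<omega> - \<xi>))) x = complex_of_real (gaussian 1 x) * wave \<xi> (- x)"
proof -
  have "fourier_L1 (\<lambda>\<omega>. complex_of_real (gaussian 1 (\<omega> - \<xi>))) x
      = (\<integral>\<omega>. complex_of_real (gaussian 1 (\<omega> - \<xi>)) * wave x (- (\<omega> - \<xi>)) * wave x (- \<xi>) \<partial>lborel)"
    unfolding fourier_L1_wave
    by (intro Bochner_Integration.integral_cong refl) (simp add: mult.assoc wave_add[symmetric])
  also have "\<dots> = (\<integral>\<omega>. complex_of_real (gaussian 1 \<omega>) * wave x (- \<omega>) * wave x (- \<xi>) \<partial>lborel)"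
    by (rule integral_lborel_shift[of "\<lambda>\<omega>. complex_of_real (gaussian 1 \<omega>) * wave x (- \<omega>) * wave x (- \<xi>)"]) measurable
  also have "\<dots> = complex_of_real (gaussian 1 x) * wave x (- \<xi>)"
    unfolding integral_mult_left_zero using gaussian_fourier(2)[of 1 x] by simp
  finally show ?thesis by (simp add: wave_def inner_commute)
qed

lemma wave_L2_mult:
  assumes "f \<in> L2"
  shows "(\<lambda>x. f x * wave \<xi> (- x)) \<in> L2"
proof -
  have [measurable]: "f \<in> borel_measurable borel" using assms by auto
  show ?thesis using assms by (simp add: L2_iff_energy energy_def norm_mult)
qed

lemma fourier_L1_in_L2:
  assumes "g \<in> L1 \<inter> L2"
  shows "fourier_L1 g \<in> L2"
proof -
  have [measurable]: "g \<in> borel_measurable borel" using assms by auto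
  show ?thesis using assms energy_fourier_L1_le[of g] by (auto simp: L2_iff_energy)
qed

text \<open>The difference of the two sides, multiplied by a Gaussian, is integrable, and its Fourier
  transform vanishes by the multiplication formula, applied to shifted Gaussians.\<close>

lemma fourier_L2_inversion:
  assumes FT: "has_fourier_L2 f F" and F1: "F \<in> L1"
  shows "AE x in lborel. f x = fourier_L1 F (- x)"
proof -
  obtain s where s: "\<And>n. s n \<in> L1 \<inter> L2"
    and s_lim: "(\<lambda>n. L2_norm (\<lambda>x. s n x - f x)) \<longlonglongrightarrow> 0"
    and F_lim: "(\<lambda>n. L2_norm (\<lambda>\<omega>. fourier_L1 (s n) \<omega> - F \<omega>)) \<longlonglongrightarrow> 0"
    and f: "f \<in> L2" and F: "F \<in> L2"
    using FT unfolding has_fourier_L2_def by blast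
  have [measurable]: "f \<in> borel_measurable borel" "F \<in> borel_measurable borel" using f F by auto
  define f0 where "f0 x = fourier_L1 F (- x)" for x
  have [measurable]: "f0 \<in> borel_measurable borel" unfolding f0_def by measurable
  have f0: "f0 \<in> L2"
    using fourier_L1_in_L2[of F] F1 F energy_reflect[of "fourier_L1 F"] by (simp add: L2_iff_energy f0_def[abs_def])
  \<comment> \<open>The weight lies in \<open>L2\<close>, which makes products with
    \<open>L2\<close> functions integrable, and it vanishes nowhere, so that it can be cancelled at
    the end.\<close>
  define \<gamma> where "\<gamma> x = complex_of_real (gaussian 1 x)" for x :: "real ^ 'a"
  have \<gamma>: "\<gamma> \<in> L2" using gaussian_shift_L1_L2[of "0 :: real ^ 'a"] by (simp add: \<gamma>_def[abs_def])
  \<comment> \<open>Both sides equal the pairing of \<open>F\<close> with the shifted Gaussian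
    \<open>h\<close>: the left one as a limit along the sequence \<open>s\<close>, the right one by
    damped inversion, where \<open>heat 1\<close> is \<open>gaussian 1\<close>.\<close>
  have weak: "(\<integral>x. f x * (\<gamma> x * wave \<xi> (- x)) \<partial>lborel) = (\<integral>x. f0 x * (\<gamma> x * wave \<xi> (- x)) \<partial>lborel)" for \<xi>
  proof -
    define h where "h \<omega> = complex_of_real (gaussian 1 (\<omega> - \<xi>))" for \<omega>
    have h: "h \<in> L1 \<inter> L2" unfolding h_def by (rule gaussian_shift_L1_L2)
    have hhat: "fourier_L1 h x = \<gamma> x * wave \<xi> (- x)" for x
      unfolding h_def \<gamma>_def by (rule fourier_gaussian_shift)
    have "(\<lambda>n. \<integral>x. s n x * (\<gamma> x * wave \<xi> (- x)) \<partial>lborel) \<longlonglongrightarrow> (\<integral>x. f x * (\<gamma> x * wave \<xi> (- x)) \<partial>lborel)"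
      using s f \<gamma> by (intro integral_mult_tendsto wave_L2_mult L2_norm_tendsto_0_imp_energy[OF s_lim]) auto
    moreover have "(\<lambda>n. \<integral>x. fourier_L1 (s n) x * h x \<partial>lborel) \<longlonglongrightarrow> (\<integral>x. F x * h x \<partial>lborel)"
      using h by (intro integral_mult_tendsto L2_norm_tendsto_0_imp_energy[OF F_lim] fourier_L1_in_L2[OF s] F) auto
    moreover have "(\<integral>x. fourier_L1 (s n) x * h x \<partial>lborel) = (\<integral>x. s n x * (\<gamma> x * wave \<xi> (- x)) \<partial>lborel)" for n
      using s[of n] h by (simp add: integral_fourier_L1_mult hhat)
    ultimately have "(\<integral>x. f x * (\<gamma> x * wave \<xi> (- x)) \<partial>lborel) = (\<integral>x. F x * h x \<partial>lborel)"
      by (simp add: LIMSEQ_unique)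
    also have "\<dots> = (\<integral>y. F y * complex_of_real (heat 1 (y - \<xi>)) \<partial>lborel)"
      by (simp add: h_def heat_def)
    also have "\<dots> = (\<integral>x. fourier_L1 F x * (complex_of_real (gaussian 1 x) * wave \<xi> x) \<partial>lborel)"
      by (rule integral_fourier_gaussian_wave[OF F1 zero_less_one, symmetric])
    also have "\<dots> = (\<integral>x. f0 x * (\<gamma> x * wave \<xi> (- x)) \<partial>lborel)"
      unfolding f0_def \<gamma>_def
      by (subst integral_lborel_reflect[symmetric]) auto
    finally show ?thesis .
  qed
  define k where "k x = (f x - f0 x) * \<gamma> x" for x
  have "AE x in lborel. k x = 0"
  proof (rule fourier_L1_zero_imp_AE_zero)
    show "k \<in> L1" unfolding L1_def k_def using integrable_L2_mult[OF L2_diff[OF f f0] \<gamma>] by simp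
    fix \<xi>
    have "fourier_L1 k \<xi> = (\<integral>x. f x * (\<gamma> x * wave \<xi> (- x)) - f0 x * (\<gamma> x * wave \<xi> (- x)) \<partial>lborel)"
      unfolding fourier_L1_wave k_def
      by (intro Bochner_Integration.integral_cong refl) (simp add: algebra_simps)
    also have "\<dots> = 0"
      using integrable_L2_mult[OF f wave_L2_mult[OF \<gamma>, of \<xi>]] integrable_L2_mult[OF f0 wave_L2_mult[OF \<gamma>, of \<xi>]]
      by (simp add: weak)
    finally show "fourier_L1 k \<xi> = 0" .
  qed
  then show ?thesis by eventually_elim (simp add: k_def f0_def \<gamma>_def)
qed

text \<open>The factor-2 triangle inequality is used twice, from \<open>F\<close> to the transform
  of \<open>s n\<close> and from \<open>s n\<close> to \<open>f\<close>; this yields the 4, and the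
  error terms disappear in the limit.\<close>

lemma has_fourier_L2_energy_le:
  assumes "has_fourier_L2 f F"
  shows "energy F \<le> 4 * energy f"
proof -
  obtain s where s: "\<And>n. s n \<in> L1 \<inter> L2"
    and "(\<lambda>n. L2_norm (\<lambda>x. s n x - f x)) \<longlonglongrightarrow> 0"
    and "(\<lambda>n. L2_norm (\<lambda>\<omega>. fourier_L1 (s n) \<omega> - F \<omega>)) \<longlonglongrightarrow> 0"
    and f: "f \<in> L2" and F: "F \<in> L2"
    using assms unfolding has_fourier_L2_def by blast
  then have s_lim: "(\<lambda>n. energy (\<lambda>x. s n x - f x)) \<longlonglongrightarrow> 0"
    and F_lim: "(\<lambda>n. energy (\<lambda>\<omega>. fourier_L1 (s n) \<omega> - F \<omega>)) \<longlonglongrightarrow> 0"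
    by (auto intro: L2_norm_tendsto_0_imp_energy)
  have [measurable]: "f \<in> borel_measurable borel" "F \<in> borel_measurable borel" "s n \<in> borel_measurable borel" for n
    using f F s[of n] by (auto dest: L2_borel)
  let ?d = "\<lambda>n. energy (\<lambda>x. s n x - f x)" and ?e = "\<lambda>n. energy (\<lambda>\<omega>. fourier_L1 (s n) \<omega> - F \<omega>)"
  have le: "energy F \<le> 2 * ?e n + (4 * ?d n + 4 * energy f)" for n
  proof -
    have "energy F \<le> 2 * energy (fourier_L1 (s n)) + 2 * ?e n"
      using energy_diff_le[of "fourier_L1 (s n)" "\<lambda>\<omega>. fourier_L1 (s n) \<omega> - F \<omega>"] by simp
    also have "energy (fourier_L1 (s n)) \<le> energy (s n)"
      using s by (intro energy_fourier_L1_le) auto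
    also have "energy (s n) \<le> 2 * ?d n + 2 * energy f"
      using energy_add_le[of "\<lambda>x. s n x - f x" f] by simp
    also have "2 * (2 * ?d n + 2 * energy f) + 2 * ?e n = 2 * ?e n + (4 * ?d n + 4 * energy f)"
      by (simp add: distrib_left mult.assoc[symmetric] add_ac)
    finally show ?thesis by (simp add: mult_left_mono add_right_mono)
  qed
  have "(\<lambda>n. 2 * ?e n + (4 * ?d n + 4 * energy f)) \<longlonglongrightarrow> 2 * 0 + (4 * 0 + 4 * energy f)"
    by (intro tendsto_add tendsto_const ennreal_tendsto_cmult s_lim F_lim) auto
  then have "(\<lambda>n. 2 * ?e n + (4 * ?d n + 4 * energy f)) \<longlonglongrightarrow> 4 * energy f" by simp
  then show ?thesis by (rule tendsto_lowerbound) (auto simp: le)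
qed

lemma has_fourier_L2_cong_AE:
  assumes "has_fourier_L2 f F" and [measurable]: "G \<in> borel_measurable borel"
    and eq: "AE x in lborel. F x = G x"
  shows "has_fourier_L2 f G"
proof -
  have "L2_norm (\<lambda>x. u x - F x) = L2_norm (\<lambda>x. u x - G x)" for u
  proof -
    have "AE x in lborel. u x - F x = u x - G x" using eq by eventually_elim simp
    then show ?thesis unfolding L2_norm_energy by (simp only: energy_cong_AE)
  qed
  moreover have "G \<in> L2"
    using assms energy_cong_AE[OF eq] by (simp add: has_fourier_L2_def L2_iff_energy)
  ultimately show ?thesis using assms by (simp add: has_fourier_L2_def)
qed

text \<open>Cauchy-Schwarz against the indicator of a ball, which has finite measure.\<close>

lemma L2_bounded_support_imp_L1:
  assumes F: "F \<in> L2" and supp: "\<And>x. norm x \<ge> R \<Longrightarrow> F x = 0"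
  shows "F \<in> L1"
proof -
  have "energy (\<lambda>x :: real ^ 'a. indicator (ball 0 R) x :: complex) = emeasure lborel (ball (0 :: real ^ 'a) R)"
  proof -
    have "ennreal ((cmod (indicator (ball 0 R) x))\<^sup>2) = indicator (ball 0 R) x" for x :: "real ^ 'a"
      by (cases "x \<in> ball 0 R") (simp_all del: indicator_simps add: indicator_def)
    then show ?thesis by (simp add: energy_def)
  qed
  also have "\<dots> < top"
    using emeasure_bounded_finite[OF bounded_ball, of "0 :: real ^ 'a" R] by (simp add: less_top)
  finally have "(\<lambda>x :: real ^ 'a. indicator (ball 0 R) x :: complex) \<in> L2"
    by (simp add: L2_iff_energy borel_measurable_indicator)
  from integrable_L2_mult[OF F this] have "integrable lborel (\<lambda>x. F x * indicator (ball 0 R) x)" .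
  moreover have "F x * indicator (ball 0 R) x = F x" for x
    using supp[of x] by (auto simp: indicator_def)
  ultimately show ?thesis by (simp add: L1_def)
qed

lemma L2_band_representation:
  assumes "f \<in> L2_band R"
  obtains F where "F \<in> L1 \<inter> L2" "\<And>x. norm x \<ge> R \<Longrightarrow> F x = 0" "energy F \<le> 4 * energy f"
    "AE x in lborel. f x = fourier_L1 F (- x)"
proof -
  obtain F where F: "has_fourier_L2 f F" "ess_support F \<subseteq> ball 0 R"
    using assms by (auto simp: L2_band_def)
  then have [measurable]: "F \<in> borel_measurable borel" by (auto simp: has_fourier_L2_def L2_def)
  \<comment> \<open>The essential support controls \<open>F\<close> only up to a null set. The
    cut-off version vanishes at every point outside the ball, represents the same transform, and is
    integrable.\<close>
  define G where "G x = (if norm x < R then F x else 0)" for x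
  have [measurable]: "G \<in> borel_measurable borel" unfolding G_def by measurable
  have "AE x in lborel. F x = G x"
    using ess_support_AE[of F] by eventually_elim (use F(2) in \<open>auto simp: G_def\<close>)
  then have G: "has_fourier_L2 f G" by (rule has_fourier_L2_cong_AE[OF F(1) \<open>G \<in> borel_measurable borel\<close>])
  then have "G \<in> L2" by (simp add: has_fourier_L2_def)
  moreover have supp: "G x = 0" if "norm x \<ge> R" for x using that by (simp add: G_def)
  ultimately have "G \<in> L1" by (rule L2_bounded_support_imp_L1)
  show thesis
    using \<open>G \<in> L1\<close> \<open>G \<in> L2\<close> supp has_fourier_L2_energy_le[OF G] fourier_L2_inversion[OF G \<open>G \<in> L1\<close>]
    by (intro that[of G]) auto
qed

section \<open>Deformations of band-limited functions\<close>

lemma power2_norm_vec: "(norm (x :: real ^ 'd::finite))\<^sup>2 = (\<Sum>i\<in>UNIV. (x $ i)\<^sup>2)"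
  unfolding power2_norm_eq_inner inner_vec_def by (simp add: power2_eq_square)

text \<open>With \<open>d\<close> columns, each row has square sum at most
  \<open>d * (1 / (2 * d))^2 = 1 / (4 * d)\<close>; the \<open>d\<close> rows together give the
  square of 1/2. This explains the threshold on the Jacobian.\<close>

lemma norm_matrix_vector_mult_le_half:
  fixes A :: "real ^ 'd::finite ^ 'd"
  assumes A: "\<And>i j. \<bar>A $ i $ j\<bar> \<le> 1 / (2 * real CARD('d))"
  shows "norm (A *v h) \<le> 1 / 2 * norm h"
proof -
  let ?d = "real CARD('d)"
  have row: "((A *v h) $ i)\<^sup>2 \<le> (norm h)\<^sup>2 / (4 * ?d)" for i
  proof -
    have "((A *v h) $ i)\<^sup>2 \<le> (\<Sum>j\<in>UNIV. (A $ i $ j)\<^sup>2) * (\<Sum>j\<in>UNIV. (h $ j)\<^sup>2)"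
      unfolding matrix_vector_mult_def by (simp add: Cauchy_Schwarz_ineq_sum)
    also have "(\<Sum>j\<in>UNIV. (A $ i $ j)\<^sup>2) \<le> (\<Sum>j\<in>(UNIV :: 'd set). (1 / (2 * ?d))\<^sup>2)"
      using A[of i] by (intro sum_mono) (metis abs_ge_zero power2_abs power_mono)
    also have "(\<Sum>j\<in>(UNIV :: 'd set). (1 / (2 * ?d))\<^sup>2) = 1 / (4 * ?d)"
      by (simp add: power2_eq_square)
    finally show ?thesis by (simp add: power2_norm_vec sum_nonneg mult_right_mono)
  qed
  have "(norm (A *v h))\<^sup>2 \<le> (\<Sum>i\<in>(UNIV :: 'd set). (norm h)\<^sup>2 / (4 * ?d))"
    unfolding power2_norm_vec[of "A *v h"] by (intro sum_mono row)
  also have "\<dots> = (1 / 2 * norm h)\<^sup>2"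
    by (simp add: power_mult_distrib power_divide)
  finally show ?thesis by (rule power2_le_imp_le) simp
qed

lemma C1_map_half_contraction:
  fixes \<tau> :: "real ^ 'd::finite \<Rightarrow> real ^ 'd"
  assumes C1: "C1_map \<tau>" and J: "jacobian_sup_norm \<tau> \<le> ennreal (1 / (2 * real CARD('d)))"
  shows "dist (\<tau> x) (\<tau> y) \<le> 1 / 2 * dist x y"
proof -
  have entry: "\<bar>jacobian \<tau> (at x) $ i $ j\<bar> \<le> 1 / (2 * real CARD('d))" for x i j
  proof -
    have "ennreal \<bar>jacobian \<tau> (at x) $ i $ j\<bar> \<le> jacobian_sup_norm \<tau>"
      unfolding jacobian_sup_norm_def
      by (rule SUP_upper2[OF UNIV_I], rule SUP_upper2[OF UNIV_I], rule SUP_upper[OF UNIV_I])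
    also note J
    finally show ?thesis by (simp add: ennreal_le_iff)
  qed
  have "norm (\<tau> x - \<tau> y) \<le> 1 / 2 * norm (x - y)"
  proof (rule differentiable_bound[of UNIV \<tau> "\<lambda>x h. jacobian \<tau> (at x) *v h"])
    show "(\<tau> has_derivative (*v) (jacobian \<tau> (at x))) (at x within UNIV)" for x
      using C1 jacobian_works[of \<tau> "at x"] by (simp add: C1_map_def)
    show "onorm ((*v) (jacobian \<tau> (at x))) \<le> 1 / 2" for x
      by (rule onorm_bound, simp, rule norm_matrix_vector_mult_le_half, rule entry)
  qed auto
  then show ?thesis by (simp add: dist_norm)
qed

text \<open>The reverse triangle inequality, with a constant that is uniform in \<open>t\<close>:
  the whole family joining the identity to the deformation satisfies one and the same expansion
  bound.\<close>

lemma sub_half_contraction_expanding: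
  fixes \<tau> :: "'a::real_normed_vector \<Rightarrow> 'a"
  assumes \<tau>: "\<And>x y. dist (\<tau> x) (\<tau> y) \<le> 1 / 2 * dist x y" and t: "0 \<le> t" "t \<le> 1"
  shows "dist x y \<le> 2 * dist (x - t *\<^sub>R \<tau> x) (y - t *\<^sub>R \<tau> y)"
proof -
  have "x - y = ((x - t *\<^sub>R \<tau> x) - (y - t *\<^sub>R \<tau> y)) + t *\<^sub>R (\<tau> x - \<tau> y)"
    by (simp add: algebra_simps)
  then have "norm (x - y) = norm (((x - t *\<^sub>R \<tau> x) - (y - t *\<^sub>R \<tau> y)) + t *\<^sub>R (\<tau> x - \<tau> y))"
    by (rule arg_cong)
  also have "\<dots> \<le> norm ((x - t *\<^sub>R \<tau> x) - (y - t *\<^sub>R \<tau> y)) + norm (t *\<^sub>R (\<tau> x - \<tau> y))"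
    by (rule norm_triangle_ineq)
  finally have "norm (x - y) \<le> norm ((x - t *\<^sub>R \<tau> x) - (y - t *\<^sub>R \<tau> y)) + norm (t *\<^sub>R (\<tau> x - \<tau> y))" .
  moreover have "norm (t *\<^sub>R (\<tau> x - \<tau> y)) = t * norm (\<tau> x - \<tau> y)"
    using t by simp
  moreover have "t * norm (\<tau> x - \<tau> y) \<le> 1 * (1 / 2 * norm (x - y))"
    using \<tau>[of x y] t by (intro mult_mono) (auto simp: dist_norm)
  ultimately show ?thesis unfolding dist_norm by linarith
qed

section \<open>Increments of Fourier integrals along segments\<close>

text \<open>The fundamental theorem of calculus along the segment from \<open>x\<close> to
  \<open>x - v\<close>. The interval appears as an indicator over the whole line, ready for Fubini
  over \<open>lborel\<close>.\<close>

lemma wave_difference: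
  fixes x v \<omega> :: "'a::euclidean_space"
  shows "wave (x - v) \<omega> - wave x \<omega>
    = (\<integral>t. indicator {0..1::real} t *\<^sub>R (- (2 * pi * \<i> * (v \<bullet> \<omega>)) * wave (x - t *\<^sub>R v) \<omega>) \<partial>lborel)"
proof -
  \<comment> \<open>An entire function whose restriction to real \<open>t\<close> is
    \<open>wave (x - t *\<^sub>R v) \<omega>\<close>; its complex derivative yields the real
    one.\<close>
  define W where "W z = exp (\<i> * (complex_of_real (2 * pi * (x \<bullet> \<omega>)) - complex_of_real (2 * pi * (v \<bullet> \<omega>)) * z))" for z
  have W: "wave (x - t *\<^sub>R v) \<omega> = W (complex_of_real t)" for t
    by (simp add: W_def wave_def cis_conv_exp inner_diff_left algebra_simps)
  have "(\<integral>t. indicator {0..1::real} t *\<^sub>R (- (2 * pi * \<i> * (v \<bullet> \<omega>)) * wave (x - t *\<^sub>R v) \<omega>) \<partial>lborel)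
      = wave (x - 1 *\<^sub>R v) \<omega> - wave (x - 0 *\<^sub>R v) \<omega>"
  proof (rule integral_FTC_atLeastAtMost)
    show "((\<lambda>t. wave (x - t *\<^sub>R v) \<omega>) has_vector_derivative
        - (2 * pi * \<i> * (v \<bullet> \<omega>)) * wave (x - t *\<^sub>R v) \<omega>) (at t within {0..1})" for t
      unfolding W
    proof (rule has_vector_derivative_real_field)
      show "(W has_field_derivative - (2 * pi * \<i> * (v \<bullet> \<omega>)) * W (complex_of_real t)) (at (complex_of_real t))"
        unfolding W_def by (rule derivative_eq_intros refl | simp)+
    qed
    show "continuous_on {0..1} (\<lambda>t. - (2 * pi * \<i> * (v \<bullet> \<omega>)) * wave (x - t *\<^sub>R v) \<omega>)"
      unfolding wave_def by (intro continuous_intros)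
  qed simp
  then show ?thesis by simp
qed

text \<open>The symbol of the \<open>j\<close>-th partial derivative: for a band-limited
  \<open>F\<close>, the function \<open>fourier_L1 (partial_multiplier j F) (- x)\<close> plays the
  role of that derivative of \<open>fourier_L1 F (- x)\<close>. The components are kept apart so
  that the scalar Plancherel inequality applies to each.\<close>

definition partial_multiplier :: "'d \<Rightarrow> 'd::finite signal \<Rightarrow> 'd signal" where
  "partial_multiplier j F = (\<lambda>\<omega>. 2 * pi * \<i> * (\<omega> $ j) * F \<omega>)"

lemma partial_multiplier_L1:
  assumes F: "F \<in> L1" and supp: "\<forall>\<omega>. norm \<omega> \<ge> R \<longrightarrow> F \<omega> = 0"
  shows "partial_multiplier j F \<in> L1"
proof -
  have [measurable]: "F \<in> borel_measurable borel" using F by auto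
  have int: "integrable lborel (\<lambda>\<omega>. complex_of_real (2 * pi * R) * F \<omega>)"
    using F by (intro integrable_mult_right) (simp add: L1_def)
  have bound: "cmod (partial_multiplier j F \<omega>) \<le> cmod (complex_of_real (2 * pi * R) * F \<omega>)" for \<omega>
  proof (cases "norm \<omega> \<ge> R")
    case False
    then have "\<bar>\<omega> $ j\<bar> \<le> R" using component_le_norm_cart[of \<omega> j] by simp
    then show ?thesis by (auto simp: partial_multiplier_def norm_mult intro!: mult_right_mono)
  qed (simp add: partial_multiplier_def supp)
  have "partial_multiplier j F \<in> borel_measurable lborel"
    unfolding partial_multiplier_def by measurable
  then have "integrable lborel (partial_multiplier j F)"
    by (rule Bochner_Integration.integrable_bound[OF int]) (rule AE_I2, rule bound)
  then show ?thesis by (simp add: L1_def)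
qed

text \<open>The symbols are summed before they are bounded: their squares add up to
  \<open>(2 * pi * norm \<omega>)^2\<close>, so the dimension does not enter the constant.\<close>

lemma energy_partial_multiplier_sum_le:
  assumes F: "F \<in> L1" and supp: "\<forall>\<omega>. norm \<omega> \<ge> R \<longrightarrow> F \<omega> = 0"
  shows "(\<Sum>j\<in>UNIV. energy (partial_multiplier j F)) \<le> ennreal ((2 * pi * R)\<^sup>2) * energy F"
proof -
  have [measurable]: "F \<in> borel_measurable borel" using F by auto
  have "(\<Sum>j\<in>UNIV. energy (partial_multiplier j F))
      = (\<integral>\<^sup>+\<omega>. (\<Sum>j\<in>UNIV. ennreal ((cmod (partial_multiplier j F \<omega>))\<^sup>2)) \<partial>lborel)"
    unfolding energy_def partial_multiplier_def by (rule nn_integral_sum[symmetric]) measurable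
  also have "\<dots> \<le> (\<integral>\<^sup>+\<omega>. ennreal ((2 * pi * R)\<^sup>2) * ennreal ((cmod (F \<omega>))\<^sup>2) \<partial>lborel)"
  proof (rule nn_integral_mono)
    fix \<omega> :: "real ^ 'a"
    have "(\<Sum>j\<in>UNIV. (cmod (partial_multiplier j F \<omega>))\<^sup>2) = (2 * pi * norm \<omega>)\<^sup>2 * (cmod (F \<omega>))\<^sup>2"
      by (simp add: partial_multiplier_def norm_mult power_mult_distrib power2_norm_vec sum_distrib_left sum_distrib_right)
    also have "\<dots> \<le> (2 * pi * R)\<^sup>2 * (cmod (F \<omega>))\<^sup>2"
    proof (cases "norm \<omega> \<ge> R")
      case False
      then show ?thesis by (intro mult_right_mono power_mono) auto
    qed (simp add: supp)
    finally have "ennreal (\<Sum>j\<in>UNIV. (cmod (partial_multiplier j F \<omega>))\<^sup>2) \<le> ennreal ((2 * pi * R)\<^sup>2 * (cmod (F \<omega>))\<^sup>2)"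
      by (rule ennreal_leI)
    then show "(\<Sum>j\<in>UNIV. ennreal ((cmod (partial_multiplier j F \<omega>))\<^sup>2)) \<le> ennreal ((2 * pi * R)\<^sup>2) * ennreal ((cmod (F \<omega>))\<^sup>2)"
      by (simp only: sum_ennreal[symmetric] zero_le_power2 ennreal_mult)
  qed
  also have "\<dots> = ennreal ((2 * pi * R)\<^sup>2) * energy F"
    unfolding energy_def by (rule nn_integral_cmult) measurable
  finally show ?thesis .
qed

lemma fourier_L1_uminus: "fourier_L1 F (- z) = (\<integral>\<omega>. F \<omega> * wave z \<omega> \<partial>lborel)"
  by (simp add: fourier_L1_wave wave_minus)

lemma integrable_mult_wave': "F \<in> L1 \<Longrightarrow> integrable lborel (\<lambda>\<omega>. F \<omega> * wave z \<omega>)"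
  using integrable_mult_wave[of F "- z"] by (simp add: L1_def wave_minus)

text \<open>The identity for one character is integrated against \<open>F\<close>. Fubini applies
  because the characters have modulus 1 and the multiplied transform is integrable on the
  band.\<close>

lemma fourier_difference:
  assumes F: "F \<in> L1" and supp: "\<forall>\<omega>. norm \<omega> \<ge> R \<longrightarrow> F \<omega> = 0"
  shows "fourier_L1 F (- (x - v)) - fourier_L1 F (- x)
    = (\<integral>t. indicator {0..1::real} t *\<^sub>R (- (\<Sum>j\<in>UNIV. (v $ j) * fourier_L1 (partial_multiplier j F) (- (x - t *\<^sub>R v)))) \<partial>lborel)"
proof -
  note multL1 = partial_multiplier_L1[OF F supp]
  have [measurable]: "F \<in> borel_measurable borel" using F by auto
  define G where "G \<omega> = - (2 * pi * \<i> * (v \<bullet> \<omega>)) * F \<omega>" for \<omega>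
  have G_sum: "G = (\<lambda>\<omega>. - (\<Sum>j\<in>UNIV. (v $ j) * partial_multiplier j F \<omega>))"
    by (simp add: fun_eq_iff G_def partial_multiplier_def inner_vec_def sum_distrib_left sum_distrib_right mult_ac)
  have G: "integrable lborel G"
    unfolding G_sum using multL1 by (auto simp: L1_def)
  define I where "I t = complex_of_real (indicator {0..1} t)" for t :: real
  have I: "integrable lborel I"
    unfolding I_def by (intro integrable_of_real) simp
  have [measurable]: "I \<in> borel_measurable borel" "G \<in> borel_measurable borel" using I G by auto
  let ?H = "\<lambda>\<omega> t. wave (x - t *\<^sub>R v) \<omega> * (G \<omega> * I t)"
  have int: "integrable (lborel \<Otimes>\<^sub>M lborel) (case_prod ?H)"
    using integrable_bounded_mult(1)[OF integrable_prod_mult[OF G I], of "\<lambda>(\<omega>, t). wave (x - t *\<^sub>R v) \<omega>" 1]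
    by (simp add: case_prod_unfold)
  have "fourier_L1 F (- (x - v)) - fourier_L1 F (- x) = (\<integral>\<omega>. F \<omega> * (wave (x - v) \<omega> - wave x \<omega>) \<partial>lborel)"
    unfolding fourier_L1_uminus using integrable_mult_wave'[OF F]
    by (simp add: right_diff_distrib)
  also have "\<dots> = (\<integral>\<omega>. (\<integral>t. ?H \<omega> t \<partial>lborel) \<partial>lborel)"
    unfolding wave_difference integral_mult_right_zero[symmetric]
    by (intro Bochner_Integration.integral_cong refl) (simp add: G_def I_def scaleR_conv_of_real mult_ac)
  also have "\<dots> = (\<integral>t. (\<integral>\<omega>. ?H \<omega> t \<partial>lborel) \<partial>lborel)"
    by (rule lborel_pair.Fubini_integral[symmetric, OF int])
  also have "\<dots> = (\<integral>t. indicator {0..1::real} t *\<^sub>R (- (\<Sum>j\<in>UNIV. (v $ j) * fourier_L1 (partial_multiplier j F) (- (x - t *\<^sub>R v)))) \<partial>lborel)"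
  proof (intro Bochner_Integration.integral_cong refl)
    fix t :: real
    let ?z = "x - t *\<^sub>R v"
    have "(\<integral>\<omega>. ?H \<omega> t \<partial>lborel) = I t * (\<integral>\<omega>. G \<omega> * wave ?z \<omega> \<partial>lborel)"
      unfolding integral_mult_right_zero[symmetric]
      by (intro Bochner_Integration.integral_cong refl) (simp add: mult_ac)
    also have "(\<integral>\<omega>. G \<omega> * wave ?z \<omega> \<partial>lborel)
        = (\<integral>\<omega>. - (\<Sum>j\<in>UNIV. (v $ j) * (partial_multiplier j F \<omega> * wave ?z \<omega>)) \<partial>lborel)"
      unfolding G_sum by (intro Bochner_Integration.integral_cong refl) (simp add: sum_distrib_right mult.assoc)
    also have "\<dots> = - (\<Sum>j\<in>UNIV. (v $ j) * fourier_L1 (partial_multiplier j F) (- ?z))"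
      unfolding fourier_L1_uminus using integrable_mult_wave'[OF multL1] by simp
    finally show "(\<integral>\<omega>. ?H \<omega> t \<partial>lborel)
        = indicator {0..1::real} t *\<^sub>R (- (\<Sum>j\<in>UNIV. (v $ j) * fourier_L1 (partial_multiplier j F) (- (x - t *\<^sub>R v))))"
      by (simp add: I_def scaleR_conv_of_real)
  qed
  finally show ?thesis .
qed

lemma ennreal_norm_le_sup_norm: "ennreal (norm (h x)) \<le> sup_norm h"
  unfolding sup_norm_def by (rule SUP_upper) simp

lemma power2_cmod_sum_le:
  fixes v :: "real ^ 'd::finite" and c :: "'d \<Rightarrow> complex"
  shows "(cmod (\<Sum>j\<in>UNIV. (v $ j) * c j))\<^sup>2 \<le> (norm v)\<^sup>2 * (\<Sum>j\<in>UNIV. (cmod (c j))\<^sup>2)"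
proof -
  have "cmod (\<Sum>j\<in>UNIV. (v $ j) * c j) \<le> (\<Sum>j\<in>UNIV. \<bar>v $ j\<bar> * cmod (c j))"
    by (rule order_trans[OF norm_sum]) (simp add: norm_mult)
  then have "(cmod (\<Sum>j\<in>UNIV. (v $ j) * c j))\<^sup>2 \<le> (\<Sum>j\<in>UNIV. \<bar>v $ j\<bar> * cmod (c j))\<^sup>2"
    by (rule power_mono) simp
  also have "\<dots> \<le> (\<Sum>j\<in>UNIV. \<bar>v $ j\<bar>\<^sup>2) * (\<Sum>j\<in>UNIV. (cmod (c j))\<^sup>2)"
    by (rule Cauchy_Schwarz_ineq_sum)
  finally show ?thesis by (simp add: power2_norm_vec)
qed

text \<open>Jensen's inequality on an interval of length 1, obtained from Cauchy-Schwarz with the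
  indicator as second factor.\<close>

lemma power2_integral_unit_interval_le:
  fixes E :: "real \<Rightarrow> complex"
  assumes [measurable]: "E \<in> borel_measurable borel"
  shows "ennreal ((cmod (\<integral>t. indicator {0..1} t *\<^sub>R E t \<partial>lborel))\<^sup>2)
    \<le> (\<integral>\<^sup>+t. indicator {0..1} t * ennreal ((cmod (E t))\<^sup>2) \<partial>lborel)"
proof -
  let ?I = "indicator {0..1} :: real \<Rightarrow> ennreal"
  have "ennreal ((cmod (\<integral>t. indicator {0..1} t *\<^sub>R E t \<partial>lborel))\<^sup>2)
      = (ennreal (cmod (\<integral>t. indicator {0..1} t *\<^sub>R E t \<partial>lborel)))\<^sup>2"
    by (simp add: ennreal_power)
  also have "\<dots> \<le> (\<integral>\<^sup>+t. norm (indicator {0..1} t *\<^sub>R E t) \<partial>lborel)\<^sup>2"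
    by (intro power_mono ennreal_norm_integral_le) simp
  also have "(\<integral>\<^sup>+t. norm (indicator {0..1} t *\<^sub>R E t) \<partial>lborel) = (\<integral>\<^sup>+t. ?I t * (?I t * ennreal (cmod (E t))) \<partial>lborel)"
    by (intro nn_integral_cong) (auto simp: indicator_def)
  also have "\<dots>\<^sup>2 \<le> (\<integral>\<^sup>+t. (?I t)\<^sup>2 \<partial>lborel) * (\<integral>\<^sup>+t. (?I t * ennreal (cmod (E t)))\<^sup>2 \<partial>lborel)"
    by (rule Cauchy_Schwarz_nn_integral) measurable
  also have "(\<integral>\<^sup>+t. (?I t)\<^sup>2 \<partial>lborel) = (\<integral>\<^sup>+t. ?I t \<partial>lborel)"
    by (intro nn_integral_cong) (auto simp: indicator_def)
  also have "\<dots> = 1" by simp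
  also have "(\<integral>\<^sup>+t. (?I t * ennreal (cmod (E t)))\<^sup>2 \<partial>lborel) = (\<integral>\<^sup>+t. ?I t * ennreal ((cmod (E t))\<^sup>2) \<partial>lborel)"
    by (intro nn_integral_cong) (auto simp: indicator_def ennreal_power)
  finally show ?thesis by simp
qed

text \<open>At a fixed point the displacement is a single vector, so the segment formula holds with
  \<open>v = \<tau> x\<close>. Jensen moves the square under the \<open>t\<close>-integral, and
  Cauchy-Schwarz over the components separates \<open>\<tau> x\<close> from the gradient.\<close>

lemma energy_fourier_deformation_le:
  fixes \<tau> :: "real ^ 'd::finite \<Rightarrow> real ^ 'd"
  assumes F: "F \<in> L1" and supp: "\<forall>\<omega>. norm \<omega> \<ge> R \<longrightarrow> F \<omega> = 0"
    and [measurable]: "\<tau> \<in> borel_measurable borel"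
    and \<tau>: "\<And>x y. dist (\<tau> x) (\<tau> y) \<le> 1 / 2 * dist x y"
  shows "energy (\<lambda>x. fourier_L1 F (- (x - \<tau> x)) - fourier_L1 F (- x))
    \<le> ennreal (4 ^ CARD('d)) * (ennreal ((2 * pi * R)\<^sup>2) * energy F) * (sup_norm \<tau>)\<^sup>2"
proof -
  define D where "D j y = fourier_L1 (partial_multiplier j F) (- y)" for j y
  have [measurable]: "F \<in> borel_measurable borel" using F by auto
  have [measurable]: "partial_multiplier j F \<in> borel_measurable borel" for j
    unfolding partial_multiplier_def by measurable
  have D_meas [measurable]: "D j \<in> borel_measurable borel" for j
    unfolding D_def by measurable
  let ?I = "indicator {0..1} :: real \<Rightarrow> ennreal"
  let ?S = "\<lambda>x t. \<Sum>j\<in>UNIV. ennreal ((cmod (D j (x - t *\<^sub>R \<tau> x)))\<^sup>2)"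
  have point: "ennreal ((cmod (fourier_L1 F (- (x - \<tau> x)) - fourier_L1 F (- x)))\<^sup>2)
      \<le> (\<integral>\<^sup>+t. ?I t * ((sup_norm \<tau>)\<^sup>2 * ?S x t) \<partial>lborel)" for x
  proof -
    let ?E = "\<lambda>t. - (\<Sum>j\<in>UNIV. (\<tau> x $ j) * D j (x - t *\<^sub>R \<tau> x))"
    have "ennreal ((cmod (fourier_L1 F (- (x - \<tau> x)) - fourier_L1 F (- x)))\<^sup>2)
        \<le> (\<integral>\<^sup>+t. ?I t * ennreal ((cmod (?E t))\<^sup>2) \<partial>lborel)"
      by (simp only: fourier_difference[OF F supp, of x "\<tau> x"] D_def[symmetric])
        (rule power2_integral_unit_interval_le, measurable)
    also have "\<dots> \<le> (\<integral>\<^sup>+t. ?I t * ((sup_norm \<tau>)\<^sup>2 * ?S x t) \<partial>lborel)"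
    proof (intro nn_integral_mono mult_left_mono)
      fix t
      have "ennreal ((cmod (?E t))\<^sup>2) \<le> ennreal ((norm (\<tau> x))\<^sup>2 * (\<Sum>j\<in>UNIV. (cmod (D j (x - t *\<^sub>R \<tau> x)))\<^sup>2))"
        unfolding norm_minus_cancel by (intro ennreal_leI power2_cmod_sum_le)
      also have "\<dots> = (ennreal (norm (\<tau> x)))\<^sup>2 * ?S x t"
        by (simp add: ennreal_mult sum_nonneg ennreal_power)
      also have "\<dots> \<le> (sup_norm \<tau>)\<^sup>2 * ?S x t"
        by (intro mult_right_mono power_mono ennreal_norm_le_sup_norm) auto
      finally show "ennreal ((cmod (?E t))\<^sup>2) \<le> (sup_norm \<tau>)\<^sup>2 * ?S x t" .
    qed auto
    finally show ?thesis .
  qed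
  have inner: "(\<integral>\<^sup>+x. ?S x t \<partial>lborel) \<le> ennreal (4 ^ CARD('d)) * (ennreal ((2 * pi * R)\<^sup>2) * energy F)"
    if t: "0 \<le> t" "t \<le> 1" for t
  proof -
    have "(\<integral>\<^sup>+x. ?S x t \<partial>lborel) = (\<Sum>j\<in>UNIV. \<integral>\<^sup>+x. ennreal ((cmod (D j (x - t *\<^sub>R \<tau> x)))\<^sup>2) \<partial>lborel)"
      by (rule nn_integral_sum) measurable
    also have "\<dots> \<le> (\<Sum>j\<in>UNIV. ennreal (4 ^ CARD('d)) * energy (partial_multiplier j F))"
    proof (rule sum_mono)
      fix j
      have "(\<integral>\<^sup>+x. ennreal ((cmod (D j (x - t *\<^sub>R \<tau> x)))\<^sup>2) \<partial>lborel)
          \<le> ennreal (4 ^ DIM(real ^ 'd)) * (\<integral>\<^sup>+x. ennreal ((cmod (D j x))\<^sup>2) \<partial>lborel)"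
        by (rule nn_integral_expanding_le[where G = "\<lambda>x. x - t *\<^sub>R \<tau> x"])
          (auto intro!: sub_half_contraction_expanding[OF \<tau> t])
      also have "(\<integral>\<^sup>+x. ennreal ((cmod (D j x))\<^sup>2) \<partial>lborel) = energy (fourier_L1 (partial_multiplier j F))"
        using energy_reflect[of "fourier_L1 (partial_multiplier j F)"] by (simp add: D_def energy_def)
      also have "\<dots> \<le> energy (partial_multiplier j F)"
        by (intro energy_fourier_L1_le partial_multiplier_L1[OF F supp])
      finally show "(\<integral>\<^sup>+x. ennreal ((cmod (D j (x - t *\<^sub>R \<tau> x)))\<^sup>2) \<partial>lborel)
          \<le> ennreal (4 ^ CARD('d)) * energy (partial_multiplier j F)"
        by (simp add: mult_left_mono)
    qed
    also have "\<dots> \<le> ennreal (4 ^ CARD('d)) * (ennreal ((2 * pi * R)\<^sup>2) * energy F)"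
      unfolding sum_distrib_left[symmetric]
      by (intro mult_left_mono energy_partial_multiplier_sum_le[OF F supp]) auto
    finally show ?thesis .
  qed
  let ?K = "ennreal (4 ^ CARD('d)) * (ennreal ((2 * pi * R)\<^sup>2) * energy F)"
  have "energy (\<lambda>x. fourier_L1 F (- (x - \<tau> x)) - fourier_L1 F (- x))
      \<le> (\<integral>\<^sup>+x. (\<integral>\<^sup>+t. ?I t * ((sup_norm \<tau>)\<^sup>2 * ?S x t) \<partial>lborel) \<partial>lborel)"
    unfolding energy_def[of "\<lambda>x. fourier_L1 F (- (x - \<tau> x)) - fourier_L1 F (- x)"]
    by (intro nn_integral_mono point)
  \<comment> \<open>For fixed \<open>t\<close> the points \<open>x - t *\<^sub>R \<tau> x\<close>
    are the values of one expanding map, so the \<open>x\<close>-integral has to become the inner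
    one.\<close>
  also have "\<dots> = (\<integral>\<^sup>+t. (\<integral>\<^sup>+x. ?I t * ((sup_norm \<tau>)\<^sup>2 * ?S x t) \<partial>lborel) \<partial>lborel)"
    by (rule lborel_pair.Fubini') measurable
  also have "\<dots> = (\<integral>\<^sup>+t. ?I t * ((sup_norm \<tau>)\<^sup>2 * (\<integral>\<^sup>+x. ?S x t \<partial>lborel)) \<partial>lborel)"
    by (intro nn_integral_cong) (simp add: nn_integral_cmult del: nn_integral_sum)
  also have "\<dots> \<le> (\<integral>\<^sup>+t. ?I t * ((sup_norm \<tau>)\<^sup>2 * ?K) \<partial>lborel)"
    by (intro nn_integral_mono) (auto simp: indicator_def simp del: sum_ennreal intro!: mult_left_mono inner)
  also have "\<dots> = ?K * (sup_norm \<tau>)\<^sup>2"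
    by (subst nn_integral_multc) (simp_all add: mult_ac)
  finally show ?thesis .
qed

section \<open>Modulation and displacement combined\<close>

lemma ennreal_power2_le_iff: "(x::ennreal)\<^sup>2 \<le> y\<^sup>2 \<longleftrightarrow> x \<le> y"
proof
  assume "x\<^sup>2 \<le> y\<^sup>2"
  then show "x \<le> y"
    by (cases x; cases y) (auto simp: ennreal_power power2_le_iff_abs_le top_power_ennreal power_mono_iff top_unique)
qed (rule power_mono, auto)

lemma cmod_exp_ii_minus_1_le: "cmod (exp (2 * complex_of_real pi * \<i> * complex_of_real t) - 1) \<le> 2 * pi * \<bar>t\<bar>"
  using iexp_approx1[of "2 * pi * t" 0] by (simp add: abs_mult mult_ac)

lemma energy_modulation_diff_le:
  assumes [measurable]: "g \<in> borel_measurable borel"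
  shows "energy (\<lambda>x. (exp (2 * complex_of_real pi * \<i> * complex_of_real (\<omega> x)) - 1) * g x)
    \<le> ennreal ((2 * pi)\<^sup>2) * (sup_norm \<omega>)\<^sup>2 * energy g"
proof -
  let ?e = "\<lambda>x. exp (2 * complex_of_real pi * \<i> * complex_of_real (\<omega> x)) - 1"
  have "energy (\<lambda>x. ?e x * g x) \<le> (\<integral>\<^sup>+x. ennreal ((2 * pi)\<^sup>2) * (sup_norm \<omega>)\<^sup>2 * ennreal ((cmod (g x))\<^sup>2) \<partial>lborel)"
    unfolding energy_def
  proof (rule nn_integral_mono)
    fix x
    have "ennreal ((cmod (?e x * g x))\<^sup>2) = ennreal ((cmod (?e x))\<^sup>2) * ennreal ((cmod (g x))\<^sup>2)"
      by (simp only: norm_mult power_mult_distrib ennreal_mult zero_le_power2)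
    also have "\<dots> \<le> ennreal ((2 * pi * \<bar>\<omega> x\<bar>)\<^sup>2) * ennreal ((cmod (g x))\<^sup>2)"
      by (intro mult_right_mono ennreal_leI power_mono cmod_exp_ii_minus_1_le) auto
    also have "ennreal ((2 * pi * \<bar>\<omega> x\<bar>)\<^sup>2) = ennreal ((2 * pi)\<^sup>2) * (ennreal (norm (\<omega> x)))\<^sup>2"
      by (simp add: power_mult_distrib ennreal_mult[symmetric] ennreal_power)
    also have "\<dots> * ennreal ((cmod (g x))\<^sup>2) \<le> ennreal ((2 * pi)\<^sup>2) * (sup_norm \<omega>)\<^sup>2 * ennreal ((cmod (g x))\<^sup>2)"
      by (intro mult_right_mono mult_left_mono power_mono ennreal_norm_le_sup_norm) auto
    finally show "ennreal ((cmod (?e x * g x))\<^sup>2) \<le> ennreal ((2 * pi)\<^sup>2) * (sup_norm \<omega>)\<^sup>2 * ennreal ((cmod (g x))\<^sup>2)" .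
  qed
  also have "\<dots> = ennreal ((2 * pi)\<^sup>2) * (sup_norm \<omega>)\<^sup>2 * energy g"
    unfolding energy_def by (rule nn_integral_cmult) measurable
  finally show ?thesis .
qed

text \<open>Preimages of null sets under an expanding map are null, as the integral bound for
  \<open>cmod (f x - g x)\<close> shows. This makes the deformation well defined on classes of
  signals.\<close>

lemma AE_comp_expanding:
  fixes f g :: "'d::finite signal" and G :: "real ^ 'd \<Rightarrow> real ^ 'd"
  assumes [measurable]: "f \<in> borel_measurable borel" "g \<in> borel_measurable borel" "G \<in> borel_measurable borel"
    and expand: "\<And>x y. dist x y \<le> 2 * dist (G x) (G y)"
    and eq: "AE x in lborel. f x = g x"
  shows "AE x in lborel. f (G x) = g (G x)"
proof -
  let ?h = "\<lambda>x. ennreal (cmod (f x - g x))"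
  have "(\<integral>\<^sup>+x. ?h x \<partial>lborel) = 0"
    using eq by (subst nn_integral_0_iff_AE) auto
  with nn_integral_expanding_le[OF \<open>G \<in> borel_measurable borel\<close> expand, of ?h]
  have "(\<integral>\<^sup>+x. ?h (G x) \<partial>lborel) = 0" by simp
  then show ?thesis by (subst (asm) nn_integral_0_iff_AE) auto
qed

context
  fixes \<tau> :: "real ^ 'd::finite \<Rightarrow> real ^ 'd"
  assumes C1: "C1_map \<tau>" and J: "jacobian_sup_norm \<tau> \<le> ennreal (1 / (2 * real CARD('d)))"
begin

lemma displacement_measurable: "\<tau> \<in> borel_measurable borel"
  using C1 by (intro borel_measurable_continuous_onI continuous_at_imp_continuous_on)
    (auto simp: C1_map_def differentiable_imp_continuous_within)

lemma displacement_expanding: "dist x y \<le> 2 * dist (x - \<tau> x) (y - \<tau> y)"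
  using sub_half_contraction_expanding[OF C1_map_half_contraction[OF C1 J], of 1] by simp

lemma energy_displacement_le:
  fixes f :: "'d signal"
  assumes [measurable]: "f \<in> borel_measurable borel"
  shows "energy (\<lambda>x. f (x - \<tau> x)) \<le> ennreal (4 ^ CARD('d)) * energy f"
  using nn_integral_expanding_le[of "\<lambda>x. x - \<tau> x" "\<lambda>x. ennreal ((cmod (f x))\<^sup>2)"]
    displacement_expanding displacement_measurable
  by (simp add: energy_def)

lemma energy_displacement_diff_le:
  assumes f: "f \<in> L2_band R"
  shows "energy (\<lambda>x. f (x - \<tau> x) - f x)
    \<le> ennreal (4 ^ CARD('d)) * (ennreal ((2 * pi * R)\<^sup>2) * (4 * energy f)) * (sup_norm \<tau>)\<^sup>2"
proof -
  note displacement_measurable [measurable]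
  obtain F where F: "F \<in> L1" "\<forall>x. norm x \<ge> R \<longrightarrow> F x = 0" "energy F \<le> 4 * energy f"
    and eq: "AE x in lborel. f x = fourier_L1 F (- x)"
    using L2_band_representation[OF f] by (metis IntD1)
  have [measurable]: "f \<in> borel_measurable borel" using f by (auto simp: L2_band_def dest: L2_borel)
  have [measurable]: "F \<in> borel_measurable borel" using F(1) by auto
  have "AE x in lborel. f (x - \<tau> x) = fourier_L1 F (- (x - \<tau> x))"
    by (rule AE_comp_expanding[where G = "\<lambda>x. x - \<tau> x", OF _ _ _ displacement_expanding eq]) measurable
  with eq have "AE x in lborel. f (x - \<tau> x) - f x = fourier_L1 F (- (x - \<tau> x)) - fourier_L1 F (- x)"
    by eventually_elim simp
  then have "energy (\<lambda>x. f (x - \<tau> x) - f x) = energy (\<lambda>x. fourier_L1 F (- (x - \<tau> x)) - fourier_L1 F (- x))"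
    by (rule energy_cong_AE)
  also have "\<dots> \<le> ennreal (4 ^ CARD('d)) * (ennreal ((2 * pi * R)\<^sup>2) * energy F) * (sup_norm \<tau>)\<^sup>2"
    by (rule energy_fourier_deformation_le[OF F(1,2) displacement_measurable C1_map_half_contraction[OF C1 J]])
  also have "\<dots> \<le> ennreal (4 ^ CARD('d)) * (ennreal ((2 * pi * R)\<^sup>2) * (4 * energy f)) * (sup_norm \<tau>)\<^sup>2"
    by (intro mult_right_mono mult_left_mono F(3)) auto
  finally show ?thesis .
qed

lemma deformation_L2:
  assumes f: "f \<in> L2" and \<omega>: "continuous_on UNIV \<omega>"
  shows "deformation \<tau> \<omega> f \<in> L2"
proof -
  note displacement_measurable [measurable]
  have [measurable]: "f \<in> borel_measurable borel" using f by auto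
  have [measurable]: "\<omega> \<in> borel_measurable borel" by (rule borel_measurable_continuous_onI[OF \<omega>])
  have "energy (deformation \<tau> \<omega> f) = energy (\<lambda>x. f (x - \<tau> x))"
    by (simp add: energy_def deformation_def norm_mult)
  also have "\<dots> \<le> ennreal (4 ^ CARD('d)) * energy f" by (rule energy_displacement_le) measurable
  also have "\<dots> < top" using f by (simp add: L2_iff_energy ennreal_mult_less_top)
  finally show ?thesis
    unfolding L2_iff_energy by (auto simp: deformation_def)
qed

text \<open>The square of the constant is \<open>16 * 4 ^ d * (2 * pi)^2\<close>:
  \<open>4 ^ d\<close> stems from the displacement, \<open>2 * pi\<close> from differentiating
  characters, and 16 from the crude triangle and Plancherel inequalities after rounding.\<close>

lemma L2_norm_deformation_diff_le:
  assumes R: "R > 0" and f: "f \<in> L2_band R" and \<omega>: "continuous_on UNIV \<omega>"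
  shows "L2_norm (\<lambda>x. deformation \<tau> \<omega> f x - f x)
    \<le> ennreal (8 * pi * 2 ^ CARD('d)) * (ennreal R * sup_norm \<tau> + sup_norm \<omega>) * L2_norm f"
proof -
  note displacement_measurable [measurable]
  have [measurable]: "f \<in> borel_measurable borel" using f by (auto simp: L2_band_def dest: L2_borel)
  have [measurable]: "\<omega> \<in> borel_measurable borel" by (rule borel_measurable_continuous_onI[OF \<omega>])
  let ?e = "\<lambda>x. exp (2 * complex_of_real pi * \<i> * complex_of_real (\<omega> x))"
  let ?a = "ennreal R * sup_norm \<tau>" and ?b = "sup_norm \<omega>" and ?c = "ennreal (4 ^ CARD('d)) * ennreal ((2 * pi)\<^sup>2)"
  \<comment> \<open>The modulation error is taken at the displaced signal, so the second term is a
    pure displacement, where band-limitation is used; the first then also carries the factor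
    \<open>4 ^ CARD('d)\<close>.\<close>
  have "(\<lambda>x. deformation \<tau> \<omega> f x - f x) = (\<lambda>x. (?e x - 1) * f (x - \<tau> x) + (f (x - \<tau> x) - f x))"
    by (simp add: fun_eq_iff deformation_def algebra_simps)
  then have "energy (\<lambda>x. deformation \<tau> \<omega> f x - f x)
      \<le> 2 * energy (\<lambda>x. (?e x - 1) * f (x - \<tau> x)) + 2 * energy (\<lambda>x. f (x - \<tau> x) - f x)"
    by (simp only:) (rule energy_add_le; measurable)
  also have "\<dots> \<le> 2 * (?c * ?b\<^sup>2 * energy f) + 2 * (4 * ?c * ?a\<^sup>2 * energy f)"
  proof (intro add_mono mult_left_mono)
    have "energy (\<lambda>x. (?e x - 1) * f (x - \<tau> x)) \<le> ennreal ((2 * pi)\<^sup>2) * ?b\<^sup>2 * energy (\<lambda>x. f (x - \<tau> x))"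
      by (rule energy_modulation_diff_le) measurable
    also have "\<dots> \<le> ennreal ((2 * pi)\<^sup>2) * ?b\<^sup>2 * (ennreal (4 ^ CARD('d)) * energy f)"
      by (intro mult_left_mono energy_displacement_le) auto
    finally show "energy (\<lambda>x. (?e x - 1) * f (x - \<tau> x)) \<le> ?c * ?b\<^sup>2 * energy f"
      by (simp add: mult_ac)
    have "ennreal ((2 * pi * R)\<^sup>2) = ennreal ((2 * pi)\<^sup>2) * (ennreal R)\<^sup>2"
      using R by (simp add: power_mult_distrib ennreal_mult[symmetric] ennreal_power)
    then show "energy (\<lambda>x. f (x - \<tau> x) - f x) \<le> 4 * ?c * ?a\<^sup>2 * energy f"
      using energy_displacement_diff_le[OF f] by (simp add: power_mult_distrib mult_ac)
  qed auto
  \<comment> \<open>The coefficients 2 and 8 are both raised to 16, which gives a common factor with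
    a rational square root.\<close>
  also have "\<dots> \<le> 16 * (?c * ?b\<^sup>2 * energy f) + 16 * (?c * ?a\<^sup>2 * energy f)"
    by (intro add_mono) (auto simp: mult.assoc[symmetric] intro!: mult_right_mono)
  also have "\<dots> = 16 * ?c * (?a\<^sup>2 + ?b\<^sup>2) * energy f"
    by (simp add: distrib_left distrib_right mult_ac add_ac)
  also have "\<dots> \<le> 16 * ?c * (?a + ?b)\<^sup>2 * energy f"
    by (intro mult_right_mono mult_left_mono) (auto simp: power2_sum)
  also have "16 * ?c = (ennreal (8 * pi * 2 ^ CARD('d)))\<^sup>2"
  proof -
    have "(8 * pi * 2 ^ CARD('d))\<^sup>2 = 16 * (4 ^ CARD('d) * (2 * pi)\<^sup>2)"
      by (simp add: power_mult_distrib power_mult[symmetric] mult.commute[of _ 2]) (simp add: power_mult)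
    moreover have "ennreal (16 * (4 ^ CARD('d) * (2 * pi)\<^sup>2)) = ennreal 16 * ennreal (4 ^ CARD('d) * (2 * pi)\<^sup>2)"
      "ennreal (4 ^ CARD('d) * (2 * pi)\<^sup>2) = ?c"
      by (rule ennreal_mult; simp)+
    moreover have "(ennreal (8 * pi * 2 ^ CARD('d)))\<^sup>2 = ennreal ((8 * pi * 2 ^ CARD('d))\<^sup>2)"
      by (rule ennreal_power) simp
    ultimately show ?thesis by (simp only: ennreal_numeral)
  qed
  finally have "(L2_norm (\<lambda>x. deformation \<tau> \<omega> f x - f x))\<^sup>2
      \<le> (ennreal (8 * pi * 2 ^ CARD('d)) * (?a + ?b) * L2_norm f)\<^sup>2"
    by (simp only: L2_norm_power2 power_mult_distrib)
  then show ?thesis by (simp only: ennreal_power2_le_iff)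
qed

end

section \<open>The feature extractor is nonexpansive\<close>

lemma borel_measurable_convolution:
  assumes [measurable]: "f \<in> borel_measurable borel" "g \<in> borel_measurable borel"
  shows "Defs.convolution f g \<in> borel_measurable borel"
  unfolding Defs.convolution_def by measurable

lemma L2_reflect_shift:
  assumes "g \<in> L2"
  shows "(\<lambda>x. g (y - x)) \<in> L2"
proof -
  have [measurable]: "g \<in> borel_measurable borel" using assms by auto
  have "energy (\<lambda>x. g (y - x)) = energy g"
    using nn_integral_lborel_reflect[of "\<lambda>x. ennreal ((cmod (g x))\<^sup>2)" y] by (simp add: energy_def)
  with assms show ?thesis by (simp add: L2_iff_energy)
qed

text \<open>Both integrands are products of two \<open>L2\<close> functions, hence integrable, so
  the identity holds at every point \<open>y\<close> and not merely almost everywhere.\<close>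

lemma convolution_diff:
  assumes "f \<in> L2" "h \<in> L2" "g \<in> L2"
  shows "Defs.convolution f g y - Defs.convolution h g y = Defs.convolution (\<lambda>x. f x - h x) g y"
  using integrable_L2_mult[OF assms(1) L2_reflect_shift[OF assms(3)]]
    integrable_L2_mult[OF assms(2) L2_reflect_shift[OF assms(3)]]
  by (simp add: Defs.convolution_def left_diff_distrib)

lemma sum_le_infsum_ennreal:
  fixes f :: "'a \<Rightarrow> ennreal"
  assumes "finite F" "F \<subseteq> A"
  shows "sum f F \<le> infsum f A"
  by (subst nonneg_infsum_complete) (use assms in \<open>auto intro: SUP_upper\<close>)

lemma semi_discrete_frame_energy_sum_le:
  assumes "semi_discrete_frame \<Lambda> g A B" "f \<in> L2" "finite K" "K \<subseteq> \<Lambda>"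
  shows "(\<Sum>k\<in>K. energy (Defs.convolution f (g k))) \<le> ennreal B * energy f"
proof -
  have "(\<Sum>k\<in>K. energy (Defs.convolution f (g k))) \<le> (\<Sum>\<^sub>\<infinity>k\<in>\<Lambda>. energy (Defs.convolution f (g k)))"
    using assms by (intro sum_le_infsum_ennreal)
  also have "\<dots> \<le> ennreal B * energy f"
    using assms(1,2) unfolding semi_discrete_frame_def frame_sum_eq_convolution_sum L2_norm_power2 by blast
  finally show ?thesis .
qed

lemma convolution_frame_in_L2:
  assumes fr: "semi_discrete_frame \<Lambda> g A B" and f: "f \<in> L2" and k: "k \<in> \<Lambda>"
  shows "Defs.convolution f (g k) \<in> L2"
proof -
  have [measurable]: "f \<in> borel_measurable borel" using f by auto
  have [measurable]: "g k \<in> borel_measurable borel"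
    using fr k by (auto simp: semi_discrete_frame_def dest: L2_borel)
  have "energy (Defs.convolution f (g k)) \<le> ennreal B * energy f"
    using semi_discrete_frame_energy_sum_le[OF fr f, of "{k}"] k by simp
  also have "\<dots> < top" using f by (simp add: L2_iff_energy ennreal_mult_less_top)
  finally show ?thesis by (simp add: L2_iff_energy borel_measurable_convolution)
qed

lemma lipschitz_L2_operator_energy_le:
  assumes "lipschitz_L2_operator K T" "f \<in> L2" "h \<in> L2"
  shows "energy (\<lambda>x. T f x - T h x) \<le> ennreal (K\<^sup>2) * energy (\<lambda>x. f x - h x)"
proof -
  have K: "K > 0" and "L2_norm (\<lambda>x. T f x - T h x) \<le> ennreal K * L2_norm (\<lambda>x. f x - h x)"
    using assms by (auto simp: lipschitz_L2_operator_def)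
  then have "(L2_norm (\<lambda>x. T f x - T h x))\<^sup>2 \<le> (ennreal K * L2_norm (\<lambda>x. f x - h x))\<^sup>2"
    by (intro power_mono) auto
  with K show ?thesis by (simp add: power_mult_distrib L2_norm_power2 ennreal_power)
qed

lemma lipschitz_L2_operator_L2: "lipschitz_L2_operator K T \<Longrightarrow> f \<in> L2 \<Longrightarrow> T f \<in> L2"
  by (auto simp: lipschitz_L2_operator_def)

text \<open>The prefactor squares to \<open>S ^ d\<close>, the Jacobian of the dilation. The
  rescaling in a layer is thus an isometry, and pooling factors leave no trace in the
  bounds.\<close>

lemma energy_dilate:
  fixes w :: "'d::finite signal"
  assumes [measurable]: "w \<in> borel_measurable borel" and S: "S > 0"
  shows "energy (\<lambda>x. complex_of_real (S powr (real CARD('d) / 2)) * w (S *\<^sub>R x)) = energy w"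
proof -
  have "(S powr (real CARD('d) / 2))\<^sup>2 = S ^ CARD('d)"
    using S by (simp add: power2_eq_square powr_add[symmetric] powr_realpow)
  then have "energy (\<lambda>x. complex_of_real (S powr (real CARD('d) / 2)) * w (S *\<^sub>R x))
      = (\<integral>\<^sup>+x. ennreal (S ^ CARD('d)) * ennreal ((cmod (w (S *\<^sub>R x)))\<^sup>2) \<partial>lborel)"
    using S by (simp add: energy_def norm_mult power_mult_distrib ennreal_mult)
  also have "\<dots> = ennreal (S ^ CARD('d)) * (\<integral>\<^sup>+x. ennreal ((cmod (w (S *\<^sub>R x)))\<^sup>2) \<partial>lborel)"
    by (rule nn_integral_cmult) measurable
  also have "\<dots> = energy w"
    using nn_integral_lborel_affine[of "\<lambda>x. ennreal ((cmod (w x))\<^sup>2)" S 0] S by (simp add: energy_def)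
  finally show ?thesis .
qed

section \<open>Energy balance of an admissible network\<close>

locale admissible_network =
  fixes \<Omega> :: "'d::finite module_seq"
  assumes module: "module_sequence \<Omega>" and adm: "admissible \<Omega>"
begin

lemma frame: "n \<ge> 1 \<Longrightarrow> \<exists>A. semi_discrete_frame (indices \<Omega> n) (atom \<Omega> n) A (frame_bound \<Omega> n)"
  and out: "n \<ge> 1 \<Longrightarrow> out_index \<Omega> n \<in> indices \<Omega> n"
  and nonlin: "n \<ge> 1 \<Longrightarrow> lipschitz_L2_operator (nonlin_lip \<Omega> n) (nonlin \<Omega> n)"
  and pool: "n \<ge> 1 \<Longrightarrow> lipschitz_L2_operator (pool_lip \<Omega> n) (pool \<Omega> n)"
  and factor: "n \<ge> 1 \<Longrightarrow> pool_factor \<Omega> n \<ge> 1"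
  using module by (auto simp: module_sequence_def)

lemma atom_L2: "n \<ge> 1 \<Longrightarrow> k \<in> indices \<Omega> n \<Longrightarrow> atom \<Omega> n k \<in> L2"
  using frame[of n] by (auto simp: semi_discrete_frame_def)

lemma convolution_atom_L2: "n \<ge> 1 \<Longrightarrow> k \<in> indices \<Omega> n \<Longrightarrow> f \<in> L2 \<Longrightarrow> Defs.convolution f (atom \<Omega> n k) \<in> L2"
  using frame[of n] convolution_frame_in_L2 by blast

lemma pool_nonlin_L2:
  "n \<ge> 1 \<Longrightarrow> k \<in> indices \<Omega> n \<Longrightarrow> f \<in> L2 \<Longrightarrow> pool \<Omega> n (nonlin \<Omega> n (Defs.convolution f (atom \<Omega> n k))) \<in> L2"
  by (intro lipschitz_L2_operator_L2[OF pool] lipschitz_L2_operator_L2[OF nonlin] convolution_atom_L2)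

lemma layer_op_L2:
  assumes n: "n \<ge> 1" and k: "k \<in> indices \<Omega> n" and f: "f \<in> L2"
  shows "layer_op \<Omega> n k f \<in> L2"
proof -
  define w where "w = pool \<Omega> n (nonlin \<Omega> n (Defs.convolution f (atom \<Omega> n k)))"
  have w: "w \<in> L2" unfolding w_def using assms by (rule pool_nonlin_L2)
  then have [measurable]: "w \<in> borel_measurable borel" by auto
  have "layer_op \<Omega> n k f = (\<lambda>x. complex_of_real (pool_factor \<Omega> n powr (real CARD('d) / 2)) * w (pool_factor \<Omega> n *\<^sub>R x))"
    by (simp add: layer_op_def w_def)
  then show ?thesis
    using w factor[OF n] by (simp add: L2_iff_energy energy_dilate)
qed

text \<open>The isometric rescaling is removed, the two Lipschitz bounds are applied from the
  outside in, and the linearity of convolution gathers the difference at the innermost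
  place.\<close>

lemma energy_layer_op_diff_le:
  assumes n: "n \<ge> 1" and k: "k \<in> indices \<Omega> n" and f: "f \<in> L2" and h: "h \<in> L2"
  shows "energy (\<lambda>x. layer_op \<Omega> n k f x - layer_op \<Omega> n k h x)
      \<le> ennreal ((nonlin_lip \<Omega> n)\<^sup>2 * (pool_lip \<Omega> n)\<^sup>2) * energy (Defs.convolution (\<lambda>x. f x - h x) (atom \<Omega> n k))"
proof -
  let ?P = "pool \<Omega> n" and ?M = "nonlin \<Omega> n" and ?f = "Defs.convolution f (atom \<Omega> n k)" and ?h = "Defs.convolution h (atom \<Omega> n k)"
  define w where "w x = ?P (?M ?f) x - ?P (?M ?h) x" for x
  have "w \<in> L2"
    unfolding w_def using assms by (intro L2_diff pool_nonlin_L2)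
  then have [measurable]: "w \<in> borel_measurable borel" by auto
  have fL: "?f \<in> L2" and hL: "?h \<in> L2" using assms convolution_atom_L2 by auto
  have nonlin_mem: "?M ?f \<in> L2" "?M ?h \<in> L2"
    using fL hL n by (auto intro: lipschitz_L2_operator_L2[OF nonlin])
  have "energy (\<lambda>x. layer_op \<Omega> n k f x - layer_op \<Omega> n k h x) = energy w"
    using energy_dilate[of w "pool_factor \<Omega> n"] factor[OF n]
    by (simp add: layer_op_def w_def right_diff_distrib)
  also have "\<dots> \<le> ennreal ((pool_lip \<Omega> n)\<^sup>2) * energy (\<lambda>x. ?M ?f x - ?M ?h x)"
    unfolding w_def by (rule lipschitz_L2_operator_energy_le[OF pool[OF n] nonlin_mem])
  also have "\<dots> \<le> ennreal ((pool_lip \<Omega> n)\<^sup>2) * (ennreal ((nonlin_lip \<Omega> n)\<^sup>2) * energy (\<lambda>x. ?f x - ?h x))"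
    by (intro mult_left_mono lipschitz_L2_operator_energy_le[OF nonlin[OF n] fL hL]) auto
  also have "(\<lambda>x. ?f x - ?h x) = Defs.convolution (\<lambda>x. f x - h x) (atom \<Omega> n k)"
    using convolution_diff[OF f h atom_L2[OF n k]] by (simp add: fun_eq_iff)
  finally show ?thesis by (simp add: ennreal_mult mult_ac)
qed

text \<open>Layers are counted from \<open>n\<close>, here and in \<open>paths_from\<close>, so that
  the tail of a path is again a path, starting one layer later; this is the form that induction
  requires. The case \<open>n = 1\<close> is \<open>features\<close>.\<close>

definition features_from :: "nat \<Rightarrow> 'd signal \<Rightarrow> nat list \<Rightarrow> 'd signal" where
  "features_from n f q = Defs.convolution (path_op_from \<Omega> n q f) (atom \<Omega> (n + length q) (out_index \<Omega> (n + length q)))"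

definition paths_from :: "nat \<Rightarrow> nat list set" where
  "paths_from n = {q. \<forall>i<length q. q ! i \<in> indices \<Omega> (n + i) - {out_index \<Omega> (n + i)}}"

lemma paths_from_Cons:
  "k # q \<in> paths_from n \<longleftrightarrow> k \<in> indices \<Omega> n - {out_index \<Omega> n} \<and> q \<in> paths_from (Suc n)"
  by (auto simp: paths_from_def All_less_Suc2)

text \<open>The output atom and the atoms in \<open>K\<close> are distinct members of one frame, so
  their convolution energies share a single upper frame bound.\<close>

lemma energy_layer_sum_le:
  assumes n: "n \<ge> 1" and u: "u \<in> L2" and v: "v \<in> L2"
    and K: "finite K" "K \<subseteq> indices \<Omega> n - {out_index \<Omega> n}"
  shows "energy (Defs.convolution (\<lambda>x. u x - v x) (atom \<Omega> n (out_index \<Omega> n)))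
      + (\<Sum>k\<in>K. energy (\<lambda>x. layer_op \<Omega> n k u x - layer_op \<Omega> n k v x)) \<le> energy (\<lambda>x. u x - v x)"
proof -
  \<comment> \<open>One factor serves all atoms: the output atom needs 1, the others the squared
    Lipschitz constants. As the frame bound is positive, admissibility says exactly
    \<open>c * frame_bound \<Omega> n \<le> 1\<close>.\<close>
  define c where "c = max 1 ((nonlin_lip \<Omega> n)\<^sup>2 * (pool_lip \<Omega> n)\<^sup>2)"
  let ?g = "\<lambda>k. energy (Defs.convolution (\<lambda>x. u x - v x) (atom \<Omega> n k))" and ?o = "out_index \<Omega> n"
  obtain A where fr: "semi_discrete_frame (indices \<Omega> n) (atom \<Omega> n) A (frame_bound \<Omega> n)"
    using frame[OF n] by blast
  then have B: "frame_bound \<Omega> n > 0" by (simp add: semi_discrete_frame_def)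
  have c: "c \<ge> 1" "c * frame_bound \<Omega> n \<le> 1"
    using adm n B by (auto simp: c_def admissible_def max_def mult_ac split: if_splits)
  have "(\<Sum>k\<in>K. energy (\<lambda>x. layer_op \<Omega> n k u x - layer_op \<Omega> n k v x)) \<le> (\<Sum>k\<in>K. ennreal c * ?g k)"
  proof (rule sum_mono)
    fix k assume "k \<in> K"
    then have "energy (\<lambda>x. layer_op \<Omega> n k u x - layer_op \<Omega> n k v x)
        \<le> ennreal ((nonlin_lip \<Omega> n)\<^sup>2 * (pool_lip \<Omega> n)\<^sup>2) * ?g k"
      using K n u v by (intro energy_layer_op_diff_le) auto
    also have "\<dots> \<le> ennreal c * ?g k" by (intro mult_right_mono ennreal_leI) (auto simp: c_def)
    finally show "energy (\<lambda>x. layer_op \<Omega> n k u x - layer_op \<Omega> n k v x) \<le> ennreal c * ?g k" .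
  qed
  moreover have "?g ?o \<le> ennreal c * ?g ?o"
    using mult_right_mono[of 1 "ennreal c" "?g ?o"] c(1) by (simp add: ennreal_leI)
  ultimately have "?g ?o + (\<Sum>k\<in>K. energy (\<lambda>x. layer_op \<Omega> n k u x - layer_op \<Omega> n k v x))
      \<le> ennreal c * (\<Sum>k\<in>insert ?o K. ?g k)"
    using K by (subst sum.insert) (auto simp: distrib_left sum_distrib_left intro: add_mono)
  also have "\<dots> \<le> ennreal c * (ennreal (frame_bound \<Omega> n) * energy (\<lambda>x. u x - v x))"
    using K out[OF n] by (intro mult_left_mono semi_discrete_frame_energy_sum_le[OF fr] L2_diff u v) auto
  also have "\<dots> = ennreal (c * frame_bound \<Omega> n) * energy (\<lambda>x. u x - v x)"
    using B c by (simp add: ennreal_mult mult.assoc)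
  also have "\<dots> \<le> 1 * energy (\<lambda>x. u x - v x)"
    using c(2) by (intro mult_right_mono) (auto simp: ennreal_le_1)
  finally show ?thesis by simp
qed

text \<open>Induction on a bound for the path lengths. The paths in \<open>F\<close> are sorted by
  first entry; each group of tails is charged, by the induction hypothesis one layer later, to the
  energy leaving that atom. The signals must be arbitrary because the tails see the outputs of the
  layer.\<close>

lemma features_from_diff_le:
  assumes "n \<ge> 1" "u \<in> L2" "v \<in> L2" "finite F" "F \<subseteq> paths_from n" "\<And>q. q \<in> F \<Longrightarrow> length q < N"
  shows "(\<Sum>q\<in>F. energy (\<lambda>x. features_from n u q x - features_from n v q x)) \<le> energy (\<lambda>x. u x - v x)"
  using assms
proof (induction N arbitrary: n u v F)
  case 0
  then have "F = {}" by auto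
  then show ?case by simp
next
  case (Suc N)
  note n = Suc.prems(1) and u = Suc.prems(2) and v = Suc.prems(3) and F = Suc.prems(4,5)
  define T where "T k = {q. k # q \<in> F}" for k
  define K where "K = hd ` (F - {[]})"
  let ?e = "\<lambda>n u v q. energy (\<lambda>x. features_from n u q x - features_from n v q x)"
  have F_eq: "F - {[]} = (\<Union>k\<in>K. (#) k ` T k)"
  proof -
    have "q \<in> (\<Union>k\<in>K. (#) k ` T k)" if "q \<in> F - {[]}" for q
      using that unfolding K_def T_def by (cases q) force+
    moreover have "(\<Union>k\<in>K. (#) k ` T k) \<subseteq> F - {[]}" by (auto simp: T_def)
    ultimately show ?thesis by blast
  qed
  have finK: "finite K" and finT: "finite (T k)" for k
    using F(1) finite_vimageI[OF F(1), of "(#) k"] by (auto simp: K_def T_def vimage_def)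
  have K_sub: "K \<subseteq> indices \<Omega> n - {out_index \<Omega> n}"
  proof
    fix k assume "k \<in> K"
    then obtain q where "q \<in> F" "q \<noteq> []" "k = hd q" by (auto simp: K_def)
    then have "k # tl q \<in> paths_from n" using F(2) by auto
    then show "k \<in> indices \<Omega> n - {out_index \<Omega> n}" by (simp add: paths_from_Cons)
  qed
  have T_sub: "T k \<subseteq> paths_from (Suc n)" for k
    using F(2) by (auto simp: T_def paths_from_Cons subset_eq)
  have e_Cons: "?e n u v (k # q) = ?e (Suc n) (layer_op \<Omega> n k u) (layer_op \<Omega> n k v) q" for k q
    by (simp add: features_from_def)
  have "(\<Sum>q\<in>F - {[]}. ?e n u v q) = (\<Sum>k\<in>K. \<Sum>q\<in>(#) k ` T k. ?e n u v q)"
    unfolding F_eq using finK finT by (intro sum.UNION_disjoint) auto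
  also have "\<dots> = (\<Sum>k\<in>K. \<Sum>q\<in>T k. ?e (Suc n) (layer_op \<Omega> n k u) (layer_op \<Omega> n k v) q)"
    by (simp add: sum.reindex e_Cons)
  also have "\<dots> \<le> (\<Sum>k\<in>K. energy (\<lambda>x. layer_op \<Omega> n k u x - layer_op \<Omega> n k v x))"
  proof (rule sum_mono)
    fix k assume "k \<in> K"
    then have "k \<in> indices \<Omega> n" using K_sub by auto
    then show "(\<Sum>q\<in>T k. ?e (Suc n) (layer_op \<Omega> n k u) (layer_op \<Omega> n k v) q)
        \<le> energy (\<lambda>x. layer_op \<Omega> n k u x - layer_op \<Omega> n k v x)"
      using n u v by (intro Suc.IH layer_op_L2 finT T_sub) (auto simp: T_def dest: Suc.prems(6))
  qed
  finally have tails: "(\<Sum>q\<in>F - {[]}. ?e n u v q) \<le> (\<Sum>k\<in>K. energy (\<lambda>x. layer_op \<Omega> n k u x - layer_op \<Omega> n k v x))" .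
  have root: "?e n u v [] = energy (Defs.convolution (\<lambda>x. u x - v x) (atom \<Omega> n (out_index \<Omega> n)))"
    using convolution_diff[OF u v atom_L2[OF n out[OF n]]] by (simp add: features_from_def)
  \<comment> \<open>The empty path may or may not belong to \<open>F\<close>; adding it can only
    enlarge the sum.\<close>
  have "(\<Sum>q\<in>F. ?e n u v q) \<le> (\<Sum>q\<in>insert [] (F - {[]}). ?e n u v q)"
    using F(1) by (intro sum_mono2) auto
  also have "\<dots> = ?e n u v [] + (\<Sum>q\<in>F - {[]}. ?e n u v q)"
    using F(1) by (subst sum.insert) auto
  also have "\<dots> \<le> energy (\<lambda>x. u x - v x)"
    using add_left_mono[OF tails, of "?e n u v []"] energy_layer_sum_le[OF n u v finK K_sub]
    unfolding root by (rule order_trans)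
  finally show ?case .
qed

text \<open>A sum of nonnegative extended values is bounded as soon as its finite partial sums are,
  and a finite set of paths has bounded length.\<close>

lemma features_diff_le:
  assumes "u \<in> L2" "v \<in> L2"
  shows "family_norm \<Omega> (\<lambda>q x. features \<Omega> u q x - features \<Omega> v q x) \<le> L2_norm (\<lambda>x. u x - v x)"
proof -
  have "(\<Sum>\<^sub>\<infinity>q\<in>paths \<Omega>. energy (\<lambda>x. features \<Omega> u q x - features \<Omega> v q x)) \<le> energy (\<lambda>x. u x - v x)"
  proof (rule infsum_le_finite_sums)
    fix F assume F: "finite F" "F \<subseteq> paths \<Omega>"
    have "F \<subseteq> paths_from 1"
      using F(2) by (fastforce simp: paths_def paths_of_length_def paths_from_def)
    moreover have "features \<Omega> w q = features_from 1 w q" for w q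
      by (simp add: features_def features_from_def path_op_def out_atom_def)
    moreover have "length q < Suc (Max (length ` F))" if "q \<in> F" for q
      using that F(1) by (simp add: less_Suc_eq_le)
    ultimately show "(\<Sum>q\<in>F. energy (\<lambda>x. features \<Omega> u q x - features \<Omega> v q x)) \<le> energy (\<lambda>x. u x - v x)"
      using features_from_diff_le[of 1 u v F "Suc (Max (length ` F))"] assms F(1) by simp
  qed (rule nonneg_summable_on_complete, simp)
  then have "(family_norm \<Omega> (\<lambda>q x. features \<Omega> u q x - features \<Omega> v q x))\<^sup>2 \<le> (L2_norm (\<lambda>x. u x - v x))\<^sup>2"
    by (simp add: family_norm_def L2_norm_power2)
  then show ?thesis by (simp only: ennreal_power2_le_iff)
qed

end

theorem theorem2:
  shows "\<exists>C::real. C > 0 \<and>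
    (\<forall>(\<Omega> :: 'd::finite module_seq) (R :: real) (f :: 'd signal)
       (\<omega> :: real ^ 'd \<Rightarrow> real) (\<tau> :: real ^ 'd \<Rightarrow> real ^ 'd).
       module_sequence \<Omega> \<longrightarrow> admissible \<Omega> \<longrightarrow> R > 0 \<longrightarrow> f \<in> L2_band R \<longrightarrow>
       continuous_on UNIV \<omega> \<longrightarrow> C1_map \<tau> \<longrightarrow>
       jacobian_sup_norm \<tau> \<le> ennreal (1 / (2 * real CARD('d))) \<longrightarrow>
       family_norm \<Omega> (\<lambda>q x. features \<Omega> (deformation \<tau> \<omega> f) q x - features \<Omega> f q x)
         \<le> ennreal C * (ennreal R * sup_norm \<tau> + sup_norm \<omega>) * L2_norm f)"
\<comment> \<open>The witness is the constant of the deformation estimate and depends on the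
  dimension alone; the network contributes a factor of 1.\<close>
proof (intro exI[of _ "8 * pi * 2 ^ CARD('d)"] conjI allI impI)
  show "0 < 8 * pi * 2 ^ CARD('d)" by simp
next
  fix \<Omega> :: "'d module_seq" and R :: real and f :: "'d signal"
    and \<omega> :: "real ^ 'd \<Rightarrow> real" and \<tau> :: "real ^ 'd \<Rightarrow> real ^ 'd"
  assume \<Omega>: "module_sequence \<Omega>" "admissible \<Omega>" and R: "R > 0" and f: "f \<in> L2_band R"
    and \<omega>: "continuous_on UNIV \<omega>"
    and \<tau>: "C1_map \<tau>" "jacobian_sup_norm \<tau> \<le> ennreal (1 / (2 * real CARD('d)))"
  interpret admissible_network \<Omega> by unfold_locales (fact \<Omega>)+
  have "f \<in> L2" using f by (simp add: L2_band_def)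
  then have "family_norm \<Omega> (\<lambda>q x. features \<Omega> (deformation \<tau> \<omega> f) q x - features \<Omega> f q x)
      \<le> L2_norm (\<lambda>x. deformation \<tau> \<omega> f x - f x)"
    by (intro features_diff_le deformation_L2[OF \<tau> _ \<omega>])
  also have "\<dots> \<le> ennreal (8 * pi * 2 ^ CARD('d)) * (ennreal R * sup_norm \<tau> + sup_norm \<omega>) * L2_norm f"
    by (rule L2_norm_deformation_diff_le[OF \<tau> R f \<omega>])
  finally show "family_norm \<Omega> (\<lambda>q x. features \<Omega> (deformation \<tau> \<omega> f) q x - features \<Omega> f q x)
      \<le> ennreal (8 * pi * 2 ^ CARD('d)) * (ennreal R * sup_norm \<tau> + sup_norm \<omega>) * L2_norm f" .
qed

end
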